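(* Let $\Lambda<\mathrm{SL}(d,\mathbb Z)$ be a finite index subgroup and let $(\Gamma_n)_n$ be any sequence of finite index subgroups of $\Gamma=\Lambda\ltimes\mathbb Z^d$ such that $[\mathbb Z^d:\Gamma_n\cap\mathbb Z^d]\to\infty$ as $n\to\infty$. Then the actions $\Gamma\curvearrowright\Gamma/\Gamma_n$ define a sofic approximation of $\Gamma$ and $$\lim_{n\to\infty}\frac{\mathrm{rank}(\Gamma_n)-1}{[\Gamma:\Gamma_n]}=0.$$
   Context: $\mathrm{rank}$ denotes the minimal number of generators. The semidirect product is with respect to the standard linear action of $\Lambda\subset\mathrm{SL}(d,\mathbb Z)$ on $\mathbb Z^d$. A sequence of actions $\Gamma\curvearrowright\Gamma/\Gamma_n$ on finite coset spaces (with uniform probability measures) defines a sofic approximation of $\Gamma$ if for every non-principal ultrafilter $\mathfrak u$ on $\mathbb N$ the ultraproduct action of $\Gamma$ on the Loeb probability space $\prod_n(\Gamma/\Gamma_n)/\mathfrak u$, $\gamma[x_n]_{\mathfrak u}=[\gamma x_n]_{\mathfrak u}$, is essentially free; equivalently, for every $\gamma\in\Gamma\setminus\{1\}$, $\frac{|\{x\in\Gamma/\Gamma_n:\gamma x=x\}|}{[\Gamma:\Gamma_n]}\to0$ as $n\to\infty$. *)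

theory Defs
  imports
    "HOL-Probability.Probability"
    "HOL-Algebra.Left_Coset"
    "HOL-Algebra.Generated_Groups"
    "HOL-Algebra.Group_Action"
    "HOL-Library.Extended_Nat"
begin

section \<open>Groups: index, rank, special linear group, semidirect product\<close>

definition group_index :: "('a, 'b) monoid_scheme \<Rightarrow> 'a set \<Rightarrow> nat" where
  "group_index G H = card (lcosets\<^bsub>G\<^esub> H)"

definition finite_index_subgroup :: "'a set \<Rightarrow> ('a, 'b) monoid_scheme \<Rightarrow> bool" where
  "finite_index_subgroup H G \<longleftrightarrow> subgroup H G \<and> finite (lcosets\<^bsub>G\<^esub> H)"

text \<open>The value is \<open>\<infinity>\<close> if the group is not finitely generated (infimum of the empty set).\<close>

definition group_rank :: "('a, 'b) monoid_scheme \<Rightarrow> enat" where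
  "group_rank G =
     (INF S \<in> {S. S \<subseteq> carrier G \<and> finite S \<and> generate G S = carrier G}. enat (card S))"

definition SL_int :: "(int ^ 'd ^ 'd) monoid" where
  "SL_int = \<lparr>carrier = {A. det A = 1}, mult = (\<lambda>A B. A ** B), one = mat 1\<rparr>"

text \<open>The pair \<open>(A, v)\<close> stands for the affine map \<open>x \<mapsto> A x + v\<close> of \<open>\<int>\<^sup>d\<close>.\<close>

definition semidirect_int :: "(int ^ 'd ^ 'd) set \<Rightarrow> ((int ^ 'd ^ 'd) \<times> (int ^ 'd)) monoid" where
  "semidirect_int \<Lambda> =
     \<lparr>carrier = \<Lambda> \<times> UNIV,
      mult = (\<lambda>(A, v) (B, w). (A ** B, v + A *v w)),
      one = (mat 1, 0)\<rparr>"

text \<open>\<open>\<int>\<^sup>d\<close> as a subgroup of \<open>\<Lambda> \<ltimes> \<int>\<^sup>d\<close>.\<close>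

definition translation_subgroup :: "((int ^ 'd ^ 'd) \<times> (int ^ 'd)) set" where
  "translation_subgroup = {mat 1} \<times> UNIV"

text \<open>Left multiplication of \<open>G\<close> on \<open>G / H\<close>; restricted because elements of \<^const>\<open>BijGroup\<close> are extensional.\<close>

definition lcoset_action :: "('a, 'b) monoid_scheme \<Rightarrow> 'a set \<Rightarrow> 'a \<Rightarrow> 'a set \<Rightarrow> 'a set" where
  "lcoset_action G H g = (\<lambda>C \<in> lcosets\<^bsub>G\<^esub> H. g <#\<^bsub>G\<^esub> C)"

section \<open>Ultraproducts of finite sets and the Loeb measure\<close>

text \<open>Ultrafilters on \<open>\<nat>\<close>, as filters: \<open>S\<close> belongs to \<open>U\<close> iff \<open>\<forall>\<^sub>F n in U. n \<in> S\<close>.\<close>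

definition nonprincipal_ultrafilter :: "nat filter \<Rightarrow> bool" where
  "nonprincipal_ultrafilter U \<longleftrightarrow>
     U \<noteq> bot \<and>
     (\<forall>P. (\<forall>\<^sub>F n in U. P n) \<or> (\<forall>\<^sub>F n in U. \<not> P n)) \<and>
     (\<forall>k. \<not> (\<forall>\<^sub>F n in U. n = k))"

definition ultra_rel :: "nat filter \<Rightarrow> (nat \<Rightarrow> 'x set) \<Rightarrow> ((nat \<Rightarrow> 'x) \<times> (nat \<Rightarrow> 'x)) set" where
  "ultra_rel U X = {(x, y). x \<in> Pi UNIV X \<and> y \<in> Pi UNIV X \<and> (\<forall>\<^sub>F n in U. x n = y n)}"

definition ultraproduct :: "nat filter \<Rightarrow> (nat \<Rightarrow> 'x set) \<Rightarrow> (nat \<Rightarrow> 'x) set set" where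
  "ultraproduct U X = Pi UNIV X // ultra_rel U X"

text \<open>The internal set \<open>[A\<^sub>n]\<^sub>U\<close>.\<close>

definition internal_set ::
  "nat filter \<Rightarrow> (nat \<Rightarrow> 'x set) \<Rightarrow> (nat \<Rightarrow> 'x set) \<Rightarrow> (nat \<Rightarrow> 'x) set set" where
  "internal_set U X A =
     {ultra_rel U X `` {x} | x. x \<in> Pi UNIV X \<and> (\<forall>\<^sub>F n in U. x n \<in> A n)}"

text \<open>The Loeb measure of the uniform probability measures on the finite sets \<open>X n\<close>: the
  measure on the \<open>\<sigma>\<close>-algebra generated by the internal sets that sends \<open>[A\<^sub>n]\<^sub>U\<close> to the
  ultralimit of \<open>|A\<^sub>n| / |X\<^sub>n|\<close>. By \<open>emeasure_loeb_internal\<close> below, the extension exists, so that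
  \<^const>\<open>extend_measure\<close> does not fall back to the zero measure.\<close>

definition loeb_measure :: "nat filter \<Rightarrow> (nat \<Rightarrow> 'x set) \<Rightarrow> (nat \<Rightarrow> 'x) set measure" where
  "loeb_measure U X =
     extend_measure (ultraproduct U X) {A. \<forall>n. A n \<subseteq> X n} (internal_set U X)
       (\<lambda>A. ennreal (Lim U (\<lambda>n. real (card (A n)) / real (card (X n)))))"

definition ultra_action ::
  "nat filter \<Rightarrow> (nat \<Rightarrow> 'x set) \<Rightarrow> (nat \<Rightarrow> 'g \<Rightarrow> 'x \<Rightarrow> 'x) \<Rightarrow> 'g \<Rightarrow> (nat \<Rightarrow> 'x) set \<Rightarrow> (nat \<Rightarrow> 'x) set"
  where
  "ultra_action U X \<phi> g C = ultra_rel U X `` ((\<lambda>x n. \<phi> n g (x n)) ` C)"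

definition essentially_free ::
  "('g, 'b) monoid_scheme \<Rightarrow> 'p measure \<Rightarrow> ('g \<Rightarrow> 'p \<Rightarrow> 'p) \<Rightarrow> bool" where
  "essentially_free G M \<psi> \<longleftrightarrow> (AE p in M. stabilizer G \<psi> p = {\<one>\<^bsub>G\<^esub>})"

definition sofic_approximation ::
  "('g, 'b) monoid_scheme \<Rightarrow> (nat \<Rightarrow> 'x set) \<Rightarrow> (nat \<Rightarrow> 'g \<Rightarrow> 'x \<Rightarrow> 'x) \<Rightarrow> bool" where
  "sofic_approximation G X \<phi> \<longleftrightarrow>
     (\<forall>n. finite (X n) \<and> X n \<noteq> {} \<and> group_action G (X n) (\<phi> n)) \<and>
     (\<forall>U. nonprincipal_ultrafilter U \<longrightarrow>
        essentially_free G (loeb_measure U X) (ultra_action U X \<phi>))"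

section \<open>Well-definedness of the constructions\<close>

lemma int_matrix_inverse:
  fixes A :: "int ^ 'd ^ 'd"
  assumes "det A = 1"
  shows "\<exists>C. A ** C = mat 1 \<and> C ** A = mat 1 \<and> det C = 1"
proof -
  define R :: "int ^ 'd ^ 'd \<Rightarrow> real ^ 'd ^ 'd" where "R = (\<lambda>M. \<chi> i j. of_int (M $ i $ j))"
  have R_mult: "R (M ** N) = R M ** R N" for M N
    by (simp add: R_def matrix_matrix_mult_def vec_eq_iff)
  have R_inj: "M = N" if "R M = R N" for M N
    using that by (simp add: R_def vec_eq_iff)
  have R_one: "R (mat 1) = mat 1"
    by (simp add: R_def mat_def vec_eq_iff)
  have R_det: "det (R M) = of_int (det M)" for M
    by (simp add: R_def det_def)
  define C :: "int ^ 'd ^ 'd" where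
    "C = (\<chi> k j. det (\<chi> i l. if l = k then (if i = j then 1 else 0) else A $ i $ l))"
  have "det (R A) = 1"
    using assms by (simp add: R_det)
  then obtain B where B: "R A ** B = mat 1" "B ** R A = mat 1"
    using invertible_det_nz[of "R A"] by (auto simp: invertible_def)
  have "R C $ k $ j = B $ k $ j" for k j
  proof -
    have "R A *v column j B = column j (R A ** B)"
      by (simp add: column_def matrix_vector_mult_def matrix_matrix_mult_def vec_eq_iff)
    then have AB: "(R A *v column j B) $ i = (if i = j then 1 else 0)" for i
      by (simp add: B column_def mat_def)
    have "B $ k $ j = column j B $ k * det (R A)"
      using \<open>det (R A) = 1\<close> by (simp add: column_def)
    also have "\<dots> = det (\<chi> i l. if l = k then (R A *v column j B) $ i else R A $ i $ l)"
      by (rule cramer_lemma[symmetric])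
    also have "\<dots> = det (R (\<chi> i l. if l = k then (if i = j then 1 else 0) else A $ i $ l))"
      unfolding AB by (rule arg_cong[of _ _ det]) (simp add: R_def vec_eq_iff)
    also have "\<dots> = R C $ k $ j"
      unfolding R_det by (simp add: R_def C_def)
    finally show ?thesis ..
  qed
  then have "R C = B"
    by (simp add: vec_eq_iff)
  then have "R (A ** C) = R (mat 1)" "R (C ** A) = R (mat 1)"
    using B by (simp_all add: R_mult R_one)
  then have AC: "A ** C = mat 1" "C ** A = mat 1"
    by (auto dest: R_inj)
  have "det A * det C = 1"
    by (metis AC(1) det_I det_mul)
  then show ?thesis
    using AC assms by auto
qed

lemma group_SL_int: "group (SL_int :: (int ^ 'd ^ 'd) monoid)"
  by (rule groupI)
    (auto simp: SL_int_def det_mul matrix_mul_assoc dest: int_matrix_inverse)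

lemma group_semidirect_int:
  assumes "subgroup \<Lambda> (SL_int :: (int ^ 'd ^ 'd) monoid)"
  shows "group (semidirect_int \<Lambda>)"
proof (rule groupI)
  interpret \<Lambda>: subgroup \<Lambda> SL_int by fact
  interpret SL: group "SL_int :: (int ^ 'd ^ 'd) monoid" by (rule group_SL_int)
  have mult: "A ** B \<in> \<Lambda>" if "A \<in> \<Lambda>" "B \<in> \<Lambda>" for A B
    using \<Lambda>.m_closed[OF that] by (simp add: SL_int_def)
  have one: "mat 1 \<in> \<Lambda>"
    using \<Lambda>.one_closed by (simp add: SL_int_def)
  have inv: "\<exists>B\<in>\<Lambda>. B ** A = mat 1" if "A \<in> \<Lambda>" for A
    using \<Lambda>.m_inv_closed[OF that] SL.l_inv[of A] \<Lambda>.mem_carrier[OF that]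
    by (auto simp: SL_int_def)
  show "\<one>\<^bsub>semidirect_int \<Lambda>\<^esub> \<in> carrier (semidirect_int \<Lambda>)"
    by (simp add: semidirect_int_def one)
  show "x \<otimes>\<^bsub>semidirect_int \<Lambda>\<^esub> y \<in> carrier (semidirect_int \<Lambda>)"
    if "x \<in> carrier (semidirect_int \<Lambda>)" "y \<in> carrier (semidirect_int \<Lambda>)" for x y
    using that by (auto simp: semidirect_int_def mult)
  show "x \<otimes>\<^bsub>semidirect_int \<Lambda>\<^esub> y \<otimes>\<^bsub>semidirect_int \<Lambda>\<^esub> z =
      x \<otimes>\<^bsub>semidirect_int \<Lambda>\<^esub> (y \<otimes>\<^bsub>semidirect_int \<Lambda>\<^esub> z)" for x y z
    by (cases x; cases y; cases z)
      (simp add: semidirect_int_def matrix_mul_assoc matrix_vector_mul_assoc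
        matrix_vector_right_distrib add.assoc)
  show "\<one>\<^bsub>semidirect_int \<Lambda>\<^esub> \<otimes>\<^bsub>semidirect_int \<Lambda>\<^esub> x = x" for x
    by (cases x) (simp add: semidirect_int_def)
  show "\<exists>y\<in>carrier (semidirect_int \<Lambda>). y \<otimes>\<^bsub>semidirect_int \<Lambda>\<^esub> x = \<one>\<^bsub>semidirect_int \<Lambda>\<^esub>"
    if x: "x \<in> carrier (semidirect_int \<Lambda>)" for x
  proof -
    obtain A v where Av: "x = (A, v)" "A \<in> \<Lambda>"
      using x by (auto simp: semidirect_int_def)
    from inv[OF this(2)] obtain B where B: "B \<in> \<Lambda>" "B ** A = mat 1" by auto
    show ?thesis
      by (rule bexI[of _ "(B, - (B *v v))"]) (use Av B in \<open>auto simp: semidirect_int_def\<close>)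
  qed
qed

lemma subgroup_translation_subgroup:
  assumes "subgroup \<Lambda> (SL_int :: (int ^ 'd ^ 'd) monoid)"
  shows "subgroup translation_subgroup (semidirect_int \<Lambda>)"
proof -
  interpret group "semidirect_int \<Lambda>" by (rule group_semidirect_int[OF assms])
  have one: "mat 1 \<in> \<Lambda>"
    using subgroup.one_closed[OF assms] by (simp add: SL_int_def)
  show ?thesis
  proof (rule subgroupI)
    show "translation_subgroup \<subseteq> carrier (semidirect_int \<Lambda>)"
      by (auto simp: translation_subgroup_def semidirect_int_def one)
    show "translation_subgroup \<noteq> ({} :: ((int ^ 'd ^ 'd) \<times> (int ^ 'd)) set)"
      by (simp add: translation_subgroup_def)
    fix a b :: "(int ^ 'd ^ 'd) \<times> (int ^ 'd)"
    assume a: "a \<in> translation_subgroup"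
    then obtain v where v: "a = (mat 1, v)"
      by (auto simp: translation_subgroup_def)
    have "inv\<^bsub>semidirect_int \<Lambda>\<^esub> a = (mat 1, - v)"
      by (rule inv_equality) (auto simp: v semidirect_int_def one)
    then show "inv\<^bsub>semidirect_int \<Lambda>\<^esub> a \<in> translation_subgroup"
      by (simp add: translation_subgroup_def)
    assume "b \<in> translation_subgroup"
    with a show "a \<otimes>\<^bsub>semidirect_int \<Lambda>\<^esub> b \<in> translation_subgroup"
      by (auto simp: translation_subgroup_def semidirect_int_def)
  qed
qed

lemma nonprincipal_ultrafilter_le_sequentially:
  assumes "nonprincipal_ultrafilter U"
  shows "U \<le> sequentially"
proof (rule filter_leI)
  fix P assume "eventually P sequentially"
  then obtain N where N: "\<And>n. n \<ge> N \<Longrightarrow> P n"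
    by (auto simp: eventually_sequentially)
  have "\<forall>\<^sub>F n in U. \<forall>k\<in>{..<N}. n \<noteq> k"
    using assms by (intro eventually_ball_finite) (auto simp: nonprincipal_ultrafilter_def)
  then show "eventually P U"
    by eventually_elim (use N in \<open>metis lessThan_iff linorder_not_le\<close>)
qed

lemma ultrafilter_not_iff:
  assumes "nonprincipal_ultrafilter U"
  shows "(\<forall>\<^sub>F n in U. \<not> P n) \<longleftrightarrow> \<not> (\<forall>\<^sub>F n in U. P n)"
proof
  assume *: "\<forall>\<^sub>F n in U. \<not> P n"
  show "\<not> (\<forall>\<^sub>F n in U. P n)"
  proof
    assume "\<forall>\<^sub>F n in U. P n"
    with * have "\<forall>\<^sub>F n in U. False" by eventually_elim simp
    with assms show False by (simp add: nonprincipal_ultrafilter_def)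
  qed
qed (use assms in \<open>auto simp: nonprincipal_ultrafilter_def\<close>)

lemma ultrafilter_tendsto_Lim:
  fixes f :: "nat \<Rightarrow> real"
  assumes U: "nonprincipal_ultrafilter U" and f: "\<And>n. f n \<in> {a..b}"
  shows "(f \<longlongrightarrow> Lim U f) U"
proof -
  have U_bot: "U \<noteq> bot"
    using U by (simp add: nonprincipal_ultrafilter_def)
  have "\<forall>\<^sub>F x in filtermap f U. x \<in> {a..b}"
    using f by (simp add: eventually_filtermap)
  then obtain l where l: "inf (nhds l) (filtermap f U) \<noteq> bot"
    using compact_Icc[of a b] U_bot unfolding compact_filter by (metis filtermap_bot_iff)
  have "(f \<longlongrightarrow> l) U"
  proof (rule topological_tendstoI)
    fix S assume S: "open S" "l \<in> S"
    show "\<forall>\<^sub>F n in U. f n \<in> S"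
    proof (rule ccontr)
      assume "\<not> ?thesis"
      then have "\<forall>\<^sub>F x in filtermap f U. x \<notin> S"
        using ultrafilter_not_iff[OF U] by (simp add: eventually_filtermap)
      moreover have "\<forall>\<^sub>F x in nhds l. x \<in> S"
        using S by (rule eventually_nhds_in_open)
      ultimately have "\<forall>\<^sub>F x in inf (nhds l) (filtermap f U). False"
        unfolding eventually_inf by blast
      with l show False by (simp add: eventually_False)
    qed
  qed
  with tendsto_Lim[OF U_bot] show ?thesis by metis
qed

locale finite_ultraproduct =
  fixes U :: "nat filter" and X :: "nat \<Rightarrow> 'x set"
  assumes U: "nonprincipal_ultrafilter U"
    and X: "\<And>n. finite (X n)" "\<And>n. X n \<noteq> {}"
begin

definition ratio :: "(nat \<Rightarrow> 'x set) \<Rightarrow> nat \<Rightarrow> real" where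
  "ratio A n = real (card (A n)) / real (card (X n))"

lemma U_bot: "U \<noteq> bot"
  using U by (simp add: nonprincipal_ultrafilter_def)

lemma card_X: "card (X n) > 0"
  using X by (simp add: card_gt_0_iff)

lemma equiv_ultra_rel: "equiv (Pi UNIV X) (ultra_rel U X)"
proof (rule equivI)
  show "ultra_rel U X \<subseteq> Pi UNIV X \<times> Pi UNIV X"
    by (auto simp: ultra_rel_def)
  show "refl_on (Pi UNIV X) (ultra_rel U X)"
    by (auto simp: refl_on_def ultra_rel_def)
  show "sym (ultra_rel U X)"
    by (auto simp: sym_def ultra_rel_def eq_commute)
  show "trans (ultra_rel U X)"
  proof (rule transI)
    fix x y z assume *: "(x, y) \<in> ultra_rel U X" "(y, z) \<in> ultra_rel U X"
    then have "\<forall>\<^sub>F n in U. x n = y n" "\<forall>\<^sub>F n in U. y n = z n"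
      by (auto simp: ultra_rel_def)
    then have "\<forall>\<^sub>F n in U. x n = z n" by eventually_elim simp
    with * show "(x, z) \<in> ultra_rel U X" by (auto simp: ultra_rel_def)
  qed
qed

lemma class_in_internal_iff:
  assumes "x \<in> Pi UNIV X"
  shows "ultra_rel U X `` {x} \<in> internal_set U X A \<longleftrightarrow> (\<forall>\<^sub>F n in U. x n \<in> A n)"
proof
  assume "ultra_rel U X `` {x} \<in> internal_set U X A"
  then obtain y where y: "y \<in> Pi UNIV X" "\<forall>\<^sub>F n in U. y n \<in> A n"
    "ultra_rel U X `` {x} = ultra_rel U X `` {y}"
    by (auto simp: internal_set_def)
  then have "(x, y) \<in> ultra_rel U X"
    using eq_equiv_class[OF _ equiv_ultra_rel] by blast
  then have "\<forall>\<^sub>F n in U. x n = y n" by (simp add: ultra_rel_def)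
  with y(2) show "\<forall>\<^sub>F n in U. x n \<in> A n" by eventually_elim simp
qed (use assms in \<open>auto simp: internal_set_def\<close>)

lemma internal_subset: "internal_set U X A \<subseteq> ultraproduct U X"
  by (auto simp: internal_set_def ultraproduct_def quotient_def)

lemma internal_eqI:
  assumes "\<S> \<subseteq> ultraproduct U X"
    "\<And>x. x \<in> Pi UNIV X \<Longrightarrow> ultra_rel U X `` {x} \<in> \<S> \<longleftrightarrow> (\<forall>\<^sub>F n in U. x n \<in> A n)"
  shows "internal_set U X A = \<S>"
proof (rule Set.set_eqI)
  fix c
  show "c \<in> internal_set U X A \<longleftrightarrow> c \<in> \<S>"
  proof (cases "c \<in> ultraproduct U X")
    case True
    then obtain x where "x \<in> Pi UNIV X" "c = ultra_rel U X `` {x}"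
      by (auto simp: ultraproduct_def quotient_def)
    then show ?thesis using assms(2) class_in_internal_iff by simp
  qed (use assms(1) internal_subset in blast)
qed

lemma internal_X: "internal_set U X X = ultraproduct U X"
  by (rule internal_eqI) (auto simp: ultraproduct_def quotient_def Pi_iff)

lemma internal_empty: "internal_set U X (\<lambda>_. {}) = {}"
  using U_bot by (auto simp: internal_set_def)

lemma internal_Int:
  "internal_set U X (\<lambda>n. A n \<inter> B n) = internal_set U X A \<inter> internal_set U X B"
  by (rule internal_eqI) (use internal_subset in \<open>auto simp: class_in_internal_iff eventually_conj_iff\<close>)

lemma internal_Diff:
  "internal_set U X (\<lambda>n. A n - B n) = internal_set U X A - internal_set U X B"
  by (rule internal_eqI)
    (use internal_subset in \<open>auto simp: class_in_internal_iff eventually_conj_iff ultrafilter_not_iff[OF U]\<close>)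

lemma internal_Un:
  assumes "\<And>n. A n \<subseteq> X n" "\<And>n. B n \<subseteq> X n"
  shows "internal_set U X (\<lambda>n. A n \<union> B n) = internal_set U X A \<union> internal_set U X B"
proof -
  have "internal_set U X (\<lambda>n. X n - ((X n - A n) \<inter> (X n - B n))) =
      internal_set U X A \<union> internal_set U X B"
    unfolding internal_Int internal_Diff internal_X using internal_subset by blast
  moreover have "X n - ((X n - A n) \<inter> (X n - B n)) = A n \<union> B n" for n
    using assms by blast
  ultimately show ?thesis by simp
qed

lemma internal_empty_iff:
  assumes "\<And>n. A n \<subseteq> X n"
  shows "internal_set U X A = {} \<longleftrightarrow> (\<forall>\<^sub>F n in U. A n = {})"
proof
  assume *: "internal_set U X A = {}"
  define x where "x n = (if A n = {} then SOME y. y \<in> X n else SOME y. y \<in> A n)" for n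
  have xA: "x n \<in> A n" if "A n \<noteq> {}" for n
    using that by (simp add: x_def some_in_eq)
  have "x n \<in> X n" for n
  proof (cases "A n = {}")
    case True
    then show ?thesis using X(2) by (simp add: x_def some_in_eq)
  qed (use xA assms in blast)
  then have "x \<in> Pi UNIV X" by auto
  with * have "\<not> (\<forall>\<^sub>F n in U. x n \<in> A n)"
    by (auto simp: internal_set_def)
  then have "\<forall>\<^sub>F n in U. x n \<notin> A n"
    using ultrafilter_not_iff[OF U] by blast
  then show "\<forall>\<^sub>F n in U. A n = {}"
    by eventually_elim (use xA in blast)
next
  assume *: "\<forall>\<^sub>F n in U. A n = {}"
  show "internal_set U X A = {}"
  proof (rule ccontr)
    assume "internal_set U X A \<noteq> {}"
    then obtain x where "\<forall>\<^sub>F n in U. x n \<in> A n"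
      by (auto simp: internal_set_def)
    with * have "\<forall>\<^sub>F n in U. False" by eventually_elim simp
    with U_bot show False by simp
  qed
qed

lemma ratio_tendsto:
  assumes "\<And>n. A n \<subseteq> X n"
  shows "(ratio A \<longlongrightarrow> Lim U (ratio A)) U"
proof (rule ultrafilter_tendsto_Lim[OF U])
  show "ratio A n \<in> {0..1}" for n
    using card_mono[OF X(1) assms, of n] card_X[of n] by (simp add: ratio_def)
qed

lemma Lim_ratio_nonneg:
  assumes "\<And>n. A n \<subseteq> X n"
  shows "Lim U (ratio A) \<ge> 0"
  by (rule tendsto_lowerbound[OF ratio_tendsto[OF assms]]) (use U_bot in \<open>auto simp: ratio_def\<close>)

lemma ratio_cong:
  assumes "\<And>n. A n \<subseteq> X n" "\<And>n. B n \<subseteq> X n" "internal_set U X A = internal_set U X B"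
  shows "Lim U (ratio A) = Lim U (ratio B)"
proof -
  have "\<forall>\<^sub>F n in U. A n - B n = {}" "\<forall>\<^sub>F n in U. B n - A n = {}"
    using assms internal_empty_iff[of "\<lambda>n. A n - B n"] internal_empty_iff[of "\<lambda>n. B n - A n"]
    by (auto simp: internal_Diff)
  then have "\<forall>\<^sub>F n in U. ratio A n = ratio B n"
  proof eventually_elim
    case (elim n)
    then have "A n = B n" by blast
    then show ?case by (simp add: ratio_def)
  qed
  then have "(ratio B \<longlongrightarrow> Lim U (ratio A)) U"
    using ratio_tendsto[OF assms(1)] tendsto_cong by blast
  then show ?thesis
    using tendsto_Lim[OF U_bot] by metis
qed

lemma saturation:
  assumes A: "\<And>k n. A k n \<subseteq> X n" "\<And>k. internal_set U X (A k) \<noteq> {}"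
    "decseq (\<lambda>k. internal_set U X (A k))"
  shows "(\<Inter>k. internal_set U X (A k)) \<noteq> {}"
proof -
  define B where "B k n = (\<Inter>j\<le>k. A j n)" for k n
  have B_sub: "B k n \<subseteq> X n" for k n
    using A(1) by (auto simp: B_def)
  have B_A: "B k n \<subseteq> A k n" for k n
    by (auto simp: B_def)
  have "internal_set U X (B k) = internal_set U X (A k)" for k
  proof (induction k)
    case (Suc k)
    have "B (Suc k) = (\<lambda>n. B k n \<inter> A (Suc k) n)"
      by (auto simp: B_def atMost_Suc fun_eq_iff)
    then show ?case
      using Suc decseqD[OF A(3), of k "Suc k"] by (auto simp: internal_Int)
  qed (simp add: B_def)
  then have B_ne: "\<forall>\<^sub>F n in U. B k n \<noteq> {}" for k
    using A(2)[of k] internal_empty_iff[of "B k"] B_sub ultrafilter_not_iff[OF U] by metis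
  define K where "K n = Max {k. k \<le> n \<and> B k n \<noteq> {}}" for n
  define x where "x n = (if B 0 n = {} then SOME y. y \<in> X n else SOME y. y \<in> B (K n) n)" for n
  have K: "B (K n) n \<noteq> {}" if "B 0 n \<noteq> {}" for n
  proof -
    have "K n \<in> {k. k \<le> n \<and> B k n \<noteq> {}}"
      unfolding K_def by (rule Max_in) (use that in auto)
    then show ?thesis by simp
  qed
  have xB: "x n \<in> B (K n) n" if "B 0 n \<noteq> {}" for n
    using K[OF that] that by (simp add: x_def some_in_eq)
  have "x n \<in> X n" for n
  proof (cases "B 0 n = {}")
    case True
    then show ?thesis using X(2) by (simp add: x_def some_in_eq)
  qed (use xB B_sub in blast)
  then have x: "x \<in> Pi UNIV X" by auto
  have "\<forall>\<^sub>F n in U. x n \<in> A k n" for k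
  proof -
    have "\<forall>\<^sub>F n in U. n \<ge> k"
      using nonprincipal_ultrafilter_le_sequentially[OF U] eventually_ge_at_top filter_leD by blast
    then show ?thesis
      using B_ne[of k]
    proof eventually_elim
      case (elim n)
      have "k \<le> K n"
        unfolding K_def by (rule Max_ge) (use elim in auto)
      then have "B (K n) n \<subseteq> A k n"
        by (auto simp: B_def)
      moreover have "B k n \<subseteq> B 0 n" by (auto simp: B_def)
      ultimately show ?case using xB[of n] elim by blast
    qed
  qed
  then have "ultra_rel U X `` {x} \<in> (\<Inter>k. internal_set U X (A k))"
    using class_in_internal_iff[OF x] by blast
  then show ?thesis by blast
qed

lemma loeb_extension:
  "\<exists>\<mu>. (\<forall>A. (\<forall>n. A n \<subseteq> X n) \<longrightarrow> \<mu> (internal_set U X A) = ennreal (Lim U (ratio A))) \<and>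
    measure_space (ultraproduct U X)
      (sigma_sets (ultraproduct U X) (internal_set U X ` {A. \<forall>n. A n \<subseteq> X n})) \<mu>"
proof -
  let ?I = "{A :: nat \<Rightarrow> 'x set. \<forall>n. A n \<subseteq> X n}"
  let ?M = "internal_set U X ` ?I"
  interpret ring_of_sets "ultraproduct U X" ?M
  proof (rule ring_of_setsI)
    show "?M \<subseteq> Pow (ultraproduct U X)"
      using internal_subset by blast
    show "{} \<in> ?M"
      by (rule image_eqI[of _ _ "\<lambda>_. {}"]) (auto simp: internal_empty)
    fix a b assume "a \<in> ?M" "b \<in> ?M"
    then obtain A B where AB: "A \<in> ?I" "B \<in> ?I"
      "a = internal_set U X A" "b = internal_set U X B" by blast
    show "a \<union> b \<in> ?M"
      by (rule image_eqI[of _ _ "\<lambda>n. A n \<union> B n"]) (use AB in \<open>auto simp: internal_Un\<close>)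
    show "a - b \<in> ?M"
      by (rule image_eqI[of _ _ "\<lambda>n. A n - B n"]) (use AB in \<open>auto simp: internal_Diff\<close>)
  qed
  define f :: "(nat \<Rightarrow> 'x) set set \<Rightarrow> ennreal" where
    "f S = ennreal (Lim U (ratio (SOME A. A \<in> ?I \<and> internal_set U X A = S)))" for S
  have f: "f (internal_set U X A) = ennreal (Lim U (ratio A))" if "A \<in> ?I" for A
  proof -
    let ?B = "SOME B. B \<in> ?I \<and> internal_set U X B = internal_set U X A"
    have "?B \<in> ?I \<and> internal_set U X ?B = internal_set U X A"
      by (rule someI[of _ A]) (use that in simp)
    then have "Lim U (ratio ?B) = Lim U (ratio A)"
      using that by (intro ratio_cong) auto
    then show ?thesis by (simp add: f_def)
  qed
  have f_empty: "f {} = 0"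
  proof -
    have "ratio (\<lambda>_. {}) = (\<lambda>_. 0)" by (simp add: ratio_def fun_eq_iff)
    then have "Lim U (ratio (\<lambda>_. {})) = 0"
      using tendsto_Lim[OF U_bot tendsto_const] by simp
    then show ?thesis
      using f[of "\<lambda>_. {}"] by (simp add: internal_empty)
  qed
  have "\<exists>\<mu>. (\<forall>s\<in>?M. \<mu> s = f s) \<and>
      measure_space (ultraproduct U X) (sigma_sets (ultraproduct U X) ?M) \<mu>"
  proof (rule caratheodory_empty_continuous)
    show "positive ?M f"
      by (simp add: positive_def f_empty)
    show "additive ?M f"
      unfolding additive_def
    proof (intro ballI impI)
      fix a b
      assume a: "a \<in> ?M" and b: "b \<in> ?M" and ab: "a \<inter> b = {}"
      from a obtain A where A: "\<forall>n. A n \<subseteq> X n" and a_eq: "a = internal_set U X A" by blast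
      from b obtain B where B: "\<forall>n. B n \<subseteq> X n" and b_eq: "b = internal_set U X B" by blast
      have disj: "internal_set U X A \<inter> internal_set U X B = {}"
        using ab by (simp add: a_eq b_eq)
      have "\<forall>\<^sub>F n in U. A n \<inter> B n = {}"
        using disj A internal_empty_iff[of "\<lambda>n. A n \<inter> B n"] by (simp add: internal_Int le_infI1)
      then have "\<forall>\<^sub>F n in U. ratio A n + ratio B n = ratio (\<lambda>n. A n \<union> B n) n"
      proof eventually_elim
        case (elim n)
        have "finite (A n)"
          by (rule finite_subset[OF _ X(1)[of n]]) (use A in simp)
        moreover have "finite (B n)"
          by (rule finite_subset[OF _ X(1)[of n]]) (use B in simp)
        ultimately show ?case
          using elim by (simp add: ratio_def card_Un_disjoint add_divide_distrib)
      qed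
      moreover have "((\<lambda>n. ratio A n + ratio B n) \<longlongrightarrow> Lim U (ratio A) + Lim U (ratio B)) U"
        using A B by (intro tendsto_add ratio_tendsto) auto
      ultimately have "(ratio (\<lambda>n. A n \<union> B n) \<longlongrightarrow> Lim U (ratio A) + Lim U (ratio B)) U"
        by (rule Lim_transform_eventually[rotated])
      then have "Lim U (ratio (\<lambda>n. A n \<union> B n)) = Lim U (ratio A) + Lim U (ratio B)"
        using tendsto_Lim[OF U_bot] by metis
      moreover have "f (internal_set U X A \<union> internal_set U X B) = ennreal (Lim U (ratio (\<lambda>n. A n \<union> B n)))"
        using f[of "\<lambda>n. A n \<union> B n"] internal_Un[of A B] A B by simp
      moreover have "f (internal_set U X A) = ennreal (Lim U (ratio A))"
        "f (internal_set U X B) = ennreal (Lim U (ratio B))"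
        using A B by (simp_all add: f)
      moreover have "0 \<le> Lim U (ratio A)" "0 \<le> Lim U (ratio B)"
        using A B by (simp_all add: Lim_ratio_nonneg)
      ultimately show "f (a \<union> b) = f a + f b"
        unfolding a_eq b_eq by (simp only: ennreal_plus)
    qed
    show "f S \<noteq> \<infinity>" for S
      by (simp add: f_def)
    fix S :: "nat \<Rightarrow> (nat \<Rightarrow> 'x) set set"
    assume S: "range S \<subseteq> ?M" "decseq S" "(\<Inter>i. S i) = {}"
    then have "\<forall>k. \<exists>A. A \<in> ?I \<and> S k = internal_set U X A" by blast
    from choice[OF this] obtain A
      where A: "\<And>k. A k \<in> ?I" "\<And>k. S k = internal_set U X (A k)" by blast
    have "\<exists>k. S k = {}"
    proof (rule ccontr)
      assume "\<nexists>k. S k = {}"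
      then have ne: "internal_set U X (A k) \<noteq> {}" for k
        by (simp flip: A(2))
      have dec: "decseq (\<lambda>k. internal_set U X (A k))"
        using S(2) by (simp flip: A(2))
      have "(\<Inter>k. internal_set U X (A k)) \<noteq> {}"
        by (rule saturation[OF _ ne dec]) (use A(1) in simp)
      with S(3) show False by (simp add: A(2))
    qed
    then obtain k where "S k = {}" ..
    then have "S j = {}" if "j \<ge> k" for j
      using decseqD[OF S(2) that] by blast
    then have "\<forall>\<^sub>F j in sequentially. f (S j) = 0"
      unfolding eventually_sequentially by (intro exI[of _ k]) (simp add: f_empty)
    then show "(\<lambda>i. f (S i)) \<longlonglongrightarrow> 0"
      by (rule tendsto_eventually)
  qed
  then obtain \<mu> where "\<forall>s\<in>?M. \<mu> s = f s"
    and m: "measure_space (ultraproduct U X) (sigma_sets (ultraproduct U X) ?M) \<mu>"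
    by blast
  then have "\<mu> (internal_set U X A) = ennreal (Lim U (ratio A))" if "\<forall>n. A n \<subseteq> X n" for A
    using f[of A] that by simp
  with m show ?thesis by blast
qed

lemma space_loeb: "space (loeb_measure U X) = ultraproduct U X"
  unfolding loeb_measure_def by (rule space_extend_measure) (use internal_subset in blast)

lemma sets_loeb:
  "sets (loeb_measure U X) =
    sigma_sets (ultraproduct U X) (internal_set U X ` {A. \<forall>n. A n \<subseteq> X n})"
  unfolding loeb_measure_def by (rule sets_extend_measure) (use internal_subset in blast)

lemma emeasure_loeb_internal:
  assumes "\<And>n. A n \<subseteq> X n"
  shows "emeasure (loeb_measure U X) (internal_set U X A) =
    ennreal (Lim U (\<lambda>n. real (card (A n)) / real (card (X n))))"
proof -
  obtain \<mu> where \<mu>: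
    "\<And>A. (\<forall>n. A n \<subseteq> X n) \<Longrightarrow> \<mu> (internal_set U X A) = ennreal (Lim U (ratio A))"
    "measure_space (ultraproduct U X) (sets (loeb_measure U X)) \<mu>"
    using loeb_extension unfolding sets_loeb by blast
  show ?thesis
  proof (rule emeasure_extend_measure[OF loeb_measure_def])
    show "\<mu> (internal_set U X B) = ennreal (Lim U (\<lambda>n. real (card (B n)) / real (card (X n))))"
      if "B \<in> {A. \<forall>n. A n \<subseteq> X n}" for B
      using \<mu>(1)[of B] that by (simp add: ratio_def[abs_def])
    show "internal_set U X ` {A. \<forall>n. A n \<subseteq> X n} \<subseteq> Pow (ultraproduct U X)"
      using internal_subset by blast
  qed (use \<mu>(2) assms in \<open>auto simp: measure_space_def\<close>)
qed

lemma prob_space_loeb: "prob_space (loeb_measure U X)"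
proof
  have "(\<lambda>n. real (card (X n)) / real (card (X n))) = (\<lambda>_. 1)"
    using card_X by (auto simp: fun_eq_iff)
  then have "Lim U (\<lambda>n. real (card (X n)) / real (card (X n))) = 1"
    using tendsto_Lim[OF U_bot tendsto_const] by simp
  then show "emeasure (loeb_measure U X) (space (loeb_measure U X)) = 1"
    using emeasure_loeb_internal[of X] by (simp add: space_loeb internal_X)
qed

lemma ultra_action_class:
  assumes "\<And>n. \<phi> n g \<in> X n \<rightarrow> X n" "x \<in> Pi UNIV X"
  shows "ultra_action U X \<phi> g (ultra_rel U X `` {x}) = ultra_rel U X `` {\<lambda>n. \<phi> n g (x n)}"
proof -
  let ?T = "\<lambda>x n. \<phi> n g (x n)"
  have T: "?T y \<in> Pi UNIV X" if "y \<in> Pi UNIV X" for y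
    using that assms(1) by (force simp: Pi_iff)
  have *: "(?T x, ?T y) \<in> ultra_rel U X" if "(x, y) \<in> ultra_rel U X" for y
  proof -
    have "\<forall>\<^sub>F n in U. x n = y n"
      using that by (simp add: ultra_rel_def)
    then have "\<forall>\<^sub>F n in U. ?T x n = ?T y n"
      by eventually_elim simp
    then show ?thesis
      using that T by (simp add: ultra_rel_def)
  qed
  have "ultra_rel U X `` {?T y} = ultra_rel U X `` {?T x}" if "(x, y) \<in> ultra_rel U X" for y
    using equiv_class_eq[OF equiv_ultra_rel *[OF that]] by simp
  moreover have "(x, x) \<in> ultra_rel U X"
    using assms(2) by (simp add: ultra_rel_def)
  ultimately show ?thesis
    unfolding ultra_action_def by blast
qed

end

end

theory Submission
  imports Defs
begin

text \<open>
  Rank: let \<open>L\<close> be the translation lattice of a finite index subgroup \<open>H\<close> and \<open>k\<close> the index of its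
  linear part in \<open>\<Lambda>\<close>. Since \<open>SL(d, \<int>)\<close> is generated by transvections, Schreier's lemma generates the
  linear part by \<open>O(k)\<close> elements, and \<open>L\<close> needs at most \<open>d\<close> more, whereas \<open>[\<Gamma> : H] \<ge> k [\<int>\<^sup>d : L]\<close>.

  Fixed points: suppose that \<open>\<gamma> \<noteq> 1\<close> fixes a proportion at least \<open>\<epsilon>\<close> of \<open>\<Gamma> / H\<close>. The conjugates of \<open>\<gamma>\<close>
  fix the same proportion, so by pigeonhole two of any \<open>O(1/\<epsilon>)\<close> conjugates, and hence their quotient,
  fix a common set of proportion bounded below. Conjugating by translations turns \<open>\<gamma>\<close> into a
  translation, and conjugating by powers of transvections in \<open>\<Lambda>\<close> then produces, one axis after the
  other, a \<open>c\<close> depending only on \<open>\<gamma>\<close> and \<open>\<epsilon>\<close> such that \<open>c \<int>\<^sup>d\<close> fixes a coset. As \<open>c \<int>\<^sup>d\<close> is normal, it is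
  contained in \<open>H\<close>, which bounds \<open>[\<int>\<^sup>d : L]\<close>.
\<close>

section \<open>Generation of the special linear group by transvections\<close>

definition transvection :: "'d::finite \<Rightarrow> 'd \<Rightarrow> int \<Rightarrow> int ^ 'd ^ 'd" where
  "transvection i j c = (\<chi> k l. if k = i \<and> l = j then c else if k = l then 1 else 0)"

lemma transvection_mult_nth:
  assumes "i \<noteq> j"
  shows "(transvection i j c ** A) $ k $ l = A $ k $ l + (if k = i then c * A $ j $ l else 0)"
proof -
  have "(transvection i j c ** A) $ k $ l =
      (\<Sum>h\<in>UNIV. (if h = k then A $ h $ l else 0) + (if h = j then (if k = i then c * A $ h $ l else 0) else 0))"
    unfolding matrix_matrix_mult_def transvection_def
    by (simp, rule sum.cong) (use assms in auto)
  also have "\<dots> = A $ k $ l + (if k = i then c * A $ j $ l else 0)"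
    by (simp add: sum.distrib)
  finally show ?thesis .
qed

lemma transvection_mult_vec_nth:
  assumes "i \<noteq> j"
  shows "(transvection i j c *v v) $ k = v $ k + (if k = i then c * v $ j else 0)"
proof -
  have "(transvection i j c *v v) $ k =
      (\<Sum>h\<in>UNIV. (if h = k then v $ h else 0) + (if h = j then (if k = i then c * v $ h else 0) else 0))"
    unfolding matrix_vector_mult_def transvection_def
    by (simp, rule sum.cong) (use assms in auto)
  also have "\<dots> = v $ k + (if k = i then c * v $ j else 0)"
    by (simp add: sum.distrib)
  finally show ?thesis .
qed

lemma transvection_0: "transvection i j 0 = mat 1"
  if "i \<noteq> j"
  using that by (auto simp: transvection_def mat_def vec_eq_iff)

lemma transvection_add:
  assumes "i \<noteq> j"
  shows "transvection i j a ** transvection i j b = transvection i j (a + b)"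
  unfolding vec_eq_iff using assms by (auto simp: transvection_mult_nth) (auto simp: transvection_def)

lemma det_transvection:
  assumes "i \<noteq> j"
  shows "det (transvection i j c) = 1"
proof -
  have "transvection i j c = (\<chi> k. if k = i then row i (mat 1) + c *s row j (mat 1) else row k (mat 1))"
    using assms by (auto simp: transvection_def vec_eq_iff row_def mat_def)
  then show ?thesis
    using det_row_operation[OF assms, of "mat 1 :: int ^ 'a ^ 'a" c] by simp
qed

abbreviation transvections :: "(int ^ 'd ^ 'd) set" where
  "transvections \<equiv> (\<lambda>(i, j). transvection i j 1) ` {(i, j). i \<noteq> j}"

abbreviation elementary_group :: "(int ^ 'd ^ 'd) set" where
  "elementary_group \<equiv> generate SL_int transvections"

lemma transvections_subset: "transvections \<subseteq> carrier SL_int"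
  by (auto simp: SL_int_def det_transvection)

lemma SL_int_simps:
  "A \<in> carrier SL_int \<longleftrightarrow> det A = 1" "A \<otimes>\<^bsub>SL_int\<^esub> B = A ** B" "\<one>\<^bsub>SL_int\<^esub> = mat 1"
  by (simp_all add: SL_int_def)

lemma inv_transvection:
  assumes "i \<noteq> j"
  shows "inv\<^bsub>SL_int\<^esub> (transvection i j c) = transvection i j (- c)"
  by (rule group.inv_equality[OF group_SL_int])
    (use assms in \<open>auto simp: SL_int_simps transvection_add transvection_0 det_transvection\<close>)

lemma subgroup_elementary_group: "subgroup elementary_group SL_int"
  by (rule group.generate_is_subgroup[OF group_SL_int transvections_subset])

lemma elementary_mult:
  "P \<in> elementary_group \<Longrightarrow> Q \<in> elementary_group \<Longrightarrow> P ** Q \<in> elementary_group"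
  using subgroup.m_closed[OF subgroup_elementary_group] by (simp add: SL_int_simps)

lemma elementary_one: "mat 1 \<in> elementary_group"
  using subgroup.one_closed[OF subgroup_elementary_group] by (simp add: SL_int_simps)

lemma transvection_elementary:
  assumes "i \<noteq> j"
  shows "transvection i j c \<in> elementary_group"
proof -
  have nonneg: "transvection i j (int n) \<in> elementary_group" for n
  proof (induction n)
    case 0
    then show ?case using assms by (simp add: transvection_0 elementary_one)
  next
    case (Suc n)
    have "transvection i j 1 \<in> elementary_group"
      by (rule generate.incl) (use assms in auto)
    from elementary_mult[OF this Suc] show ?case
      using assms by (simp add: transvection_add)
  qed
  show ?thesis
  proof (cases "c \<ge> 0")
    case True
    then show ?thesis using nonneg[of "nat c"] by simp
  next
    case False
    then show ?thesis
      using subgroup.m_inv_closed[OF subgroup_elementary_group nonneg[of "nat (- c)"]] assms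
      by (simp add: inv_transvection)
  qed
qed

lemma det_elementary: "P \<in> elementary_group \<Longrightarrow> det P = 1"
  using subgroup.mem_carrier[OF subgroup_elementary_group] by (simp add: SL_int_simps)

section \<open>Column reduction of integral matrices by elementary row operations\<close>

definition standard_columns :: "'d set \<Rightarrow> int ^ 'd ^ 'd \<Rightarrow> bool" where
  "standard_columns T A \<longleftrightarrow> (\<forall>l\<in>T. \<forall>k. A $ k $ l = (if k = l then 1 else 0))"

text \<open>Row \<open>j\<close> vanishes in the columns \<open>T\<close> because \<open>j\<close>
  lies outside \<open>T\<close>; adding a multiple of it to another row leaves these columns
  alone.\<close>

lemma standard_columns_transvection:
  assumes "standard_columns T A" "i \<noteq> j" "j \<notin> T"
  shows "standard_columns T (transvection i j c ** A)"
  using assms by (auto simp: standard_columns_def transvection_mult_nth)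

text \<open>The subtractive Euclidean algorithm on the entries of column \<open>j\<close> in the
  rows outside \<open>T\<close>. As long as two of these entries are nonzero, a row operation
  between their rows decreases the sum of the absolute values.\<close>

lemma euclid_column:
  assumes "standard_columns T A" "j \<notin> T"
  shows "\<exists>P\<in>elementary_group. standard_columns T (P ** A) \<and>
    (\<exists>i. i \<notin> T \<and> (\<forall>k. k \<notin> T \<longrightarrow> k \<noteq> i \<longrightarrow> (P ** A) $ k $ j = 0))"
  using assms
proof (induction "\<Sum>k\<in>-T. nat \<bar>A $ k $ j\<bar>" arbitrary: A rule: less_induct)
  case less
  show ?case
  proof (cases "\<exists>i. i \<notin> T \<and> (\<forall>k. k \<notin> T \<longrightarrow> k \<noteq> i \<longrightarrow> A $ k $ j = 0)")
    case True
    then show ?thesis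
      using less.prems by (intro bexI[of _ "mat 1"]) (auto simp: elementary_one)
  next
    case False
    then obtain k where k: "k \<notin> T" "A $ k $ j \<noteq> 0"
      using less.prems(2) by blast
    with False obtain h where h: "h \<notin> T" "h \<noteq> k" "A $ h $ j \<noteq> 0"
      by blast
    define i i' where "i = (if \<bar>A $ k $ j\<bar> \<ge> \<bar>A $ h $ j\<bar> then k else h)"
      and "i' = (if \<bar>A $ k $ j\<bar> \<ge> \<bar>A $ h $ j\<bar> then h else k)"
    have ii: "i \<notin> T" "i' \<notin> T" "i \<noteq> i'" "A $ i' $ j \<noteq> 0" "\<bar>A $ i $ j\<bar> \<ge> \<bar>A $ i' $ j\<bar>"
      using k h by (auto simp: i_def i'_def)
    \<comment> \<open>With this sign the new entry of row \<open>i\<close> has absolute value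
      \<open>\<bar>A $ i $ j\<bar> - \<bar>A $ i' $ j\<bar>\<close>, since \<open>i\<close> carries
      the larger of the two entries.\<close>
    define c where "c = - sgn (A $ i $ j) * sgn (A $ i' $ j)"
    let ?B = "transvection i i' c ** A"
    have less': "\<bar>A $ i $ j + c * A $ i' $ j\<bar> < \<bar>A $ i $ j\<bar>"
      using ii(4,5) by (auto simp: c_def sgn_if split: if_splits)
    have "(\<Sum>k\<in>-T. nat \<bar>?B $ k $ j\<bar>) < (\<Sum>k\<in>-T. nat \<bar>A $ k $ j\<bar>)"
    proof (rule sum_strict_mono_ex1)
      show "\<forall>k\<in>-T. nat \<bar>?B $ k $ j\<bar> \<le> nat \<bar>A $ k $ j\<bar>"
        using ii(3) less' by (auto simp: transvection_mult_nth)
      show "\<exists>k\<in>-T. nat \<bar>?B $ k $ j\<bar> < nat \<bar>A $ k $ j\<bar>"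
        by (rule bexI[of _ i]) (use ii less' in \<open>auto simp: transvection_mult_nth\<close>)
    qed simp
    from less.hyps[OF this standard_columns_transvection[OF less.prems(1) ii(3,2)] less.prems(2)]
    obtain P where P: "P \<in> elementary_group" "standard_columns T (P ** ?B)"
      "\<exists>i. i \<notin> T \<and> (\<forall>k. k \<notin> T \<longrightarrow> k \<noteq> i \<longrightarrow> (P ** ?B) $ k $ j = 0)"
      by blast
    show ?thesis
      by (rule bexI[of _ "P ** transvection i i' c"])
        (use P ii(3) in \<open>auto simp: elementary_mult transvection_elementary matrix_mul_assoc\<close>)
  qed
qed

text \<open>The entries of row \<open>j\<close> of \<open>A\<inverse>\<close> in the columns \<open>T\<close> vanish, so that the pivot divides \<open>(A\<inverse> A) $ j $ j = 1\<close>.\<close>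

lemma pivot_unit:
  assumes "det A = 1" "standard_columns T A" "j \<notin> T" "i \<notin> T"
    and zero: "\<And>k. k \<notin> T \<Longrightarrow> k \<noteq> i \<Longrightarrow> A $ k $ j = 0"
  shows "\<bar>A $ i $ j\<bar> = 1"
proof -
  obtain C where C: "C ** A = mat 1"
    using int_matrix_inverse[OF assms(1)] by blast
  have "C $ j $ l = 0" if "l \<in> T" for l
  proof -
    have "(C ** A) $ j $ l = (\<Sum>k\<in>UNIV. if k = l then C $ j $ k else 0)"
      unfolding matrix_matrix_mult_def vec_lambda_beta
      by (rule sum.cong) (use that assms(2) in \<open>auto simp: standard_columns_def\<close>)
    also have "\<dots> = C $ j $ l"
      by simp
    finally have "C $ j $ l = mat 1 $ j $ l"
      by (simp add: C)
    then show ?thesis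
      using that assms(3) by (auto simp: mat_def)
  qed
  then have "(C ** A) $ j $ j = (\<Sum>k\<in>UNIV. if k = i then C $ j $ k * A $ k $ j else 0)"
    unfolding matrix_matrix_mult_def vec_lambda_beta
    by (intro sum.cong) (use zero assms(4) in auto)
  then have "C $ j $ i * A $ i $ j = 1"
    using C by (simp add: mat_def)
  then show ?thesis
    using zmult_eq_1_iff by fastforce
qed

text \<open>A pivot \<plusminus>1 divides every entry of its column, so one transvection per row,
  with source row \<open>j\<close>, clears the column. The rows indexed by \<open>T\<close> are
  cleared too.\<close>

lemma clear_column:
  assumes "standard_columns T A" "j \<notin> T" "\<bar>A $ j $ j\<bar> = 1"
  shows "\<exists>P\<in>elementary_group. standard_columns T (P ** A) \<and> (P ** A) $ j $ j = A $ j $ j \<and>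
    (\<forall>k. k \<noteq> j \<longrightarrow> (P ** A) $ k $ j = 0)"
proof -
  have "\<exists>P\<in>elementary_group. standard_columns T (P ** A) \<and> (P ** A) $ j $ j = A $ j $ j \<and>
    (\<forall>k\<in>K. (P ** A) $ k $ j = 0)" if "finite K" "j \<notin> K" for K
    using that
  proof (induction K rule: finite_induct)
    case empty
    then show ?case
      using assms by (intro bexI[of _ "mat 1"]) (auto simp: elementary_one)
  next
    case (insert i K)
    then obtain P where P: "P \<in> elementary_group" "standard_columns T (P ** A)"
      "(P ** A) $ j $ j = A $ j $ j" "\<forall>k\<in>K. (P ** A) $ k $ j = 0"
      by auto
    \<comment> \<open>The pivot is its own inverse, so multiplying by \<open>A $ j $ j\<close>
      replaces the division by it.\<close>
    define c where "c = - (P ** A) $ i $ j * A $ j $ j"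
    let ?t = "transvection i j c"
    have ij: "i \<noteq> j" using insert.prems by auto
    have sq: "A $ j $ j * A $ j $ j = 1"
      using assms(3) by (auto simp: abs_if split: if_splits)
    have c: "(P ** A) $ i $ j + c * A $ j $ j = 0"
      using sq by (simp add: c_def mult.assoc)
    show ?case
      using standard_columns_transvection[OF P(2) ij assms(2)] P ij c
      by (intro bexI[of _ "?t ** P"])
        (auto simp: transvection_mult_nth elementary_mult transvection_elementary
          simp flip: matrix_mul_assoc)
  qed
  from this[of "- {j}"] show ?thesis by auto
qed

text \<open>The Euclidean algorithm leaves a single nonzero entry outside \<open>T\<close> in column
  \<open>j\<close>, and \<open>pivot_unit\<close> makes it \<plusminus>1. What remains is to produce
  a pivot 1 in row \<open>j\<close> and then to clear the rest of the column, including the rows in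
  \<open>T\<close>.\<close>

lemma standardize_column:
  assumes "det A = 1" "standard_columns T A" "j \<notin> T"
  shows "\<exists>P\<in>elementary_group. standard_columns (insert j T) (P ** A)"
proof -
  obtain P i where P: "P \<in> elementary_group" "standard_columns T (P ** A)" "i \<notin> T"
    and zero: "\<And>k. k \<notin> T \<Longrightarrow> k \<noteq> i \<Longrightarrow> (P ** A) $ k $ j = 0"
    using euclid_column[OF assms(2,3)] by blast
  define B where "B = P ** A"
  have det_B: "det B = 1"
    using assms(1) P(1) by (simp add: B_def det_mul det_elementary)
  have unit: "\<bar>B $ i $ j\<bar> = 1"
    using pivot_unit[OF det_B _ assms(3) P(3)] P(2) zero by (simp add: B_def)
  then have pm: "B $ i $ j = 1 \<or> B $ i $ j = -1"
    by arith
  have "\<exists>Q\<in>elementary_group. standard_columns T (Q ** B) \<and> (Q ** B) $ j $ j = 1"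
  proof -
    have "T = - {j} \<or> (\<exists>i'. i' \<notin> T \<and> i' \<noteq> j)"
      using assms(3) by auto
    \<comment> \<open>\<open>off\<close>: row \<open>j\<close> has entry 0, and adding
      \<open>B $ i $ j\<close> times row \<open>i\<close> puts the square of a unit there.
      \<open>minus\<close>: a spare row \<open>i'\<close> first receives the entry 1, and twice this
      row then turns -1 into 1. \<open>last\<close>: there is no spare row, but clearing column
      \<open>j\<close> would leave a diagonal matrix of determinant -1.\<close>
    with pm consider (off) "i \<noteq> j" | (one) "i = j" "B $ j $ j = 1"
      | (minus) i' where "i = j" "B $ j $ j = -1" "i' \<notin> T" "i' \<noteq> j"
      | (last) "i = j" "B $ j $ j = -1" "T = - {j}"
      by blast
    then show ?thesis
    proof cases
      case off
      have "B $ i $ j * B $ i $ j = 1"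
        using pm by auto
      then show ?thesis
        using off zero[OF assms(3)] standard_columns_transvection[OF P(2) _ P(3), of j]
        by (intro bexI[of _ "transvection j i (B $ i $ j)"])
          (auto simp: transvection_mult_nth transvection_elementary B_def)
    next
      case one
      then show ?thesis
        using P by (intro bexI[of _ "mat 1"]) (auto simp: elementary_one B_def)
    next
      case minus
      have z: "B $ i' $ j = 0"
        using zero[of i'] minus by (simp add: B_def)
      have "standard_columns T (transvection j i' 2 ** (transvection i' j (-1) ** B))"
        by (intro standard_columns_transvection) (use minus assms(3) P(2) in \<open>auto simp: B_def\<close>)
      moreover have "(transvection j i' 2 ** (transvection i' j (-1) ** B)) $ j $ j = 1"
        using minus z by (simp add: transvection_mult_nth)
      ultimately show ?thesis
        using minus by (intro bexI[of _ "transvection j i' 2 ** transvection i' j (-1)"])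
          (auto simp: elementary_mult transvection_elementary matrix_mul_assoc)
    next
      case last
      obtain Q where Q: "Q \<in> elementary_group" "standard_columns T (Q ** B)"
        "(Q ** B) $ j $ j = B $ j $ j" "\<And>k. k \<noteq> j \<Longrightarrow> (Q ** B) $ k $ j = 0"
        using clear_column[of T B j] last P(2) by (auto simp: B_def)
      have "(Q ** B) $ k $ l = (if k = l then if k = j then -1 else 1 else 0)" for k l
        using Q(2,3,4) last by (cases "l = j") (auto simp: standard_columns_def)
      then have "det (Q ** B) = (\<Prod>k\<in>UNIV. if k = j then -1 else 1)"
        by (subst det_diagonal) auto
      then have "det (Q ** B) = -1" by simp
      moreover have "det (Q ** B) = 1"
        using Q(1) det_B by (simp add: det_mul det_elementary)
      ultimately show ?thesis by simp
    qed
  qed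
  then obtain Q where Q: "Q \<in> elementary_group" "standard_columns T (Q ** B)" "(Q ** B) $ j $ j = 1"
    by blast
  obtain R where R: "R \<in> elementary_group" "standard_columns T (R ** (Q ** B))"
    "(R ** (Q ** B)) $ j $ j = 1" "\<And>k. k \<noteq> j \<Longrightarrow> (R ** (Q ** B)) $ k $ j = 0"
    using clear_column[OF Q(2) assms(3)] Q(3) by auto
  have "standard_columns (insert j T) (R ** (Q ** B))"
    using R by (auto simp: standard_columns_def)
  then show ?thesis
    using P(1) Q(1) R(1)
    by (intro bexI[of _ "R ** Q ** P"]) (auto simp: elementary_mult matrix_mul_assoc B_def)
qed

text \<open>Standardizing all columns yields \<open>P ** A = mat 1\<close> with \<open>P\<close>
  elementary, so \<open>A\<close> is the inverse of \<open>P\<close>. In dimension one there are no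
  transvections and both sides are trivial.\<close>

theorem SL_int_generated: "generate SL_int transvections = carrier (SL_int :: (int ^ 'd ^ 'd) monoid)"
proof
  show "elementary_group \<subseteq> carrier SL_int"
    by (rule subgroup.subset[OF subgroup_elementary_group])
  show "carrier SL_int \<subseteq> (elementary_group :: (int ^ 'd ^ 'd) set)"
  proof
    fix A :: "int ^ 'd ^ 'd" assume "A \<in> carrier SL_int"
    then have det: "det A = 1" by (simp add: SL_int_simps)
    have "\<exists>P\<in>elementary_group. standard_columns T (P ** A)" if "finite T" for T
      using that
    proof (induction T rule: finite_induct)
      case empty
      then show ?case using elementary_one by (auto simp: standard_columns_def)
    next
      case (insert j T)
      then obtain P where P: "P \<in> elementary_group" "standard_columns T (P ** A)" by blast
      obtain Q where "Q \<in> elementary_group" "standard_columns (insert j T) (Q ** (P ** A))"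
        using standardize_column[OF _ P(2) insert.hyps(2)] P(1) det
        by (auto simp: det_mul det_elementary)
      then show ?case
        using P(1) by (intro bexI[of _ "Q ** P"]) (auto simp: elementary_mult matrix_mul_assoc)
    qed
    from this[of UNIV] obtain P where P: "P \<in> elementary_group" "standard_columns UNIV (P ** A)"
      by auto
    then have PA: "P ** A = mat 1"
      by (auto simp: standard_columns_def mat_def vec_eq_iff)
    interpret group "SL_int :: (int ^ 'd ^ 'd) monoid" by (rule group_SL_int)
    have "A \<otimes>\<^bsub>SL_int\<^esub> P = \<one>\<^bsub>SL_int\<^esub>"
      by (rule inv_comm) (use PA det P(1) in \<open>auto simp: SL_int_simps det_elementary\<close>)
    then have "inv\<^bsub>SL_int\<^esub> P = A"
      by (intro inv_equality) (use det P(1) in \<open>auto simp: SL_int_simps det_elementary\<close>)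
    then show "A \<in> elementary_group"
      using subgroup.m_inv_closed[OF subgroup_elementary_group P(1)] by simp
  qed
qed

section \<open>Generators and indices of subgroups\<close>

context group
begin

lemma l_coset_lcosets:
  assumes "subgroup H G" "g \<in> carrier G" "C \<in> lcosets H"
  shows "g <# C \<in> lcosets H"
proof -
  obtain a where "a \<in> carrier G" "C = a <# H"
    using assms(3) by (auto simp: LCOSETS_def)
  then show ?thesis
    using assms lcos_m_assoc[OF subgroup.subset[OF assms(1)], of g a] by (auto simp: LCOSETS_def)
qed

lemma lcosets_eq_l_coset:
  assumes "subgroup H G" "C \<in> lcosets H" "a \<in> C"
  shows "a \<in> carrier G" "C = a <# H"
proof -
  obtain x where "x \<in> carrier G" "C = x <# H"
    using assms(2) by (auto simp: LCOSETS_def)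
  then show "a \<in> carrier G" "C = a <# H"
    using assms l_repr_independence l_coset_carrier by blast+
qed

lemma lcosets_nonempty:
  assumes "subgroup H G" "C \<in> lcosets H"
  shows "\<exists>a. a \<in> C"
proof -
  obtain x where "x \<in> carrier G" "C = x <# H"
    using assms(2) by (auto simp: LCOSETS_def)
  then show ?thesis
    using lcos_self assms(1) by blast
qed

lemma subgroup_in_lcosets:
  assumes "subgroup H G"
  shows "H \<in> lcosets H"
  using lcos_mult_one[OF subgroup.subset[OF assms]] by (auto simp: LCOSETS_def)

lemma lcosets_quotient:
  assumes "subgroup H G" "C \<in> lcosets H" "a \<in> C" "b \<in> C"
  shows "inv a \<otimes> b \<in> H"
  using lcosets_eq_l_coset[OF assms(1-3)] subgroup.lcos_module_imp[OF assms(1) is_group] assms(4)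
  by blast

text \<open>Schreier's lemma for left cosets. The map \<open>\<sigma>\<close> below is a cocycle for
  the action on cosets with values in \<open>H\<close>, so its value at a word in \<open>S\<close>
  is a product of values at letters and of their inverses. These values form \<open>F\<close>, and
  at the coset \<open>H\<close> the cocycle restricts to the identity of \<open>H\<close>.\<close>

lemma schreier:
  assumes S: "S \<subseteq> carrier G" "finite S" "generate G S = carrier G"
    and H: "subgroup H G" "finite (lcosets H)"
  obtains F where "F \<subseteq> H" "finite F" "card F \<le> card S * card (lcosets H)" "generate G F = H"
proof -
  \<comment> \<open>Choosing \<open>\<one>\<close> as the representative of \<open>H\<close> gives
    \<open>\<sigma> h H = h\<close> for \<open>h\<close> in \<open>H\<close>.\<close>
  define \<tau> where "\<tau> C = (if C = H then \<one> else SOME a. a \<in> C)" for C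
  have \<tau>_in: "\<tau> C \<in> C" if "C \<in> lcosets H" for C
    using lcosets_nonempty[OF H(1) that] subgroup.one_closed[OF H(1)]
    by (auto simp: \<tau>_def some_in_eq)
  have \<tau>: "\<tau> C \<in> carrier G" if "C \<in> lcosets H" for C
    using lcosets_eq_l_coset[OF H(1) that \<tau>_in[OF that]] by simp
  have act: "g <# C \<in> lcosets H" if "g \<in> carrier G" "C \<in> lcosets H" for g C
    by (rule l_coset_lcosets[OF H(1) that])
  have sub: "C \<subseteq> carrier G" if "C \<in> lcosets H" for C
    by (rule subgroup.lcosets_carrier[OF H(1) is_group that])
  define \<sigma> where "\<sigma> g C = inv (\<tau> (g <# C)) \<otimes> g \<otimes> \<tau> C" for g C
  define F where "F = (\<lambda>(s, C). \<sigma> s C) ` (S \<times> lcosets H)"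
  have \<sigma>_in: "\<sigma> g C \<in> H" if "g \<in> carrier G" "C \<in> lcosets H" for g C
  proof -
    have "g \<otimes> \<tau> C \<in> g <# C"
      using \<tau>_in[OF that(2)] by (auto simp: l_coset_def)
    then have "inv (\<tau> (g <# C)) \<otimes> (g \<otimes> \<tau> C) \<in> H"
      using lcosets_quotient[OF H(1) act[OF that] \<tau>_in[OF act[OF that]]] by simp
    then show ?thesis
      using that \<tau> act by (simp add: \<sigma>_def m_assoc)
  qed
  have FH: "F \<subseteq> H"
    using \<sigma>_in S(1) by (auto simp: F_def)
  have gen: "\<sigma> g C \<in> generate G F" if "g \<in> generate G S" "C \<in> lcosets H" for g C
    using that
  proof (induction g arbitrary: C rule: generate.induct)
    case one
    then show ?case
      using \<tau> sub by (auto simp: \<sigma>_def lcos_mult_one intro: generate.one)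
  next
    case (incl s)
    then show ?case by (intro generate.incl) (auto simp: F_def)
  next
    case (inv s)
    then have s: "s \<in> carrier G" using S(1) by blast
    \<comment> \<open>The value at an inverse letter is the inverse of the Schreier generator based
      at this coset.\<close>
    let ?D = "inv s <# C"
    have D: "?D \<in> lcosets H" using act s inv by simp
    have sD: "s <# ?D = C"
      using s sub[OF inv.prems] by (simp add: lcos_m_assoc lcos_mult_one)
    have "inv (\<sigma> s ?D) = \<sigma> (inv s) C"
      using s D \<tau> inv by (simp add: \<sigma>_def sD inv_mult_group m_assoc)
    moreover have "\<sigma> s ?D \<in> F"
      using inv D by (auto simp: F_def)
    ultimately show ?case
      using generate.inv[of "\<sigma> s ?D" F G] by simp
  next
    case (eng g h)
    have gh: "g \<in> carrier G" "h \<in> carrier G"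
      using eng S(3) by auto
    let ?D = "h <# C"
    have D: "?D \<in> lcosets H" using act gh eng by simp
    \<comment> \<open>The representative of the intermediate coset cancels; this is the cocycle
      identity.\<close>
    have "\<tau> ?D \<otimes> (inv (\<tau> ?D) \<otimes> y) = y" if "y \<in> carrier G" for y
      using that \<tau>[OF D] by (simp add: m_assoc[symmetric])
    then have "\<sigma> g ?D \<otimes> \<sigma> h C = \<sigma> (g \<otimes> h) C"
      using gh D eng.prems \<tau> act sub by (simp add: \<sigma>_def m_assoc lcos_m_assoc)
    then show ?case
      using generate.eng[OF eng.IH(1)[OF D] eng.IH(2)[OF eng.prems]] by simp
  qed
  have "H \<subseteq> generate G F"
  proof
    fix h assume h: "h \<in> H"
    then have hc: "h \<in> carrier G"
      using subgroup.mem_carrier[OF H(1)] by blast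
    have "h <# H = H"
      using coset_join3 h hc H(1) by blast
    then have "\<sigma> h H = h"
      using hc by (simp add: \<sigma>_def \<tau>_def)
    then show "h \<in> generate G F"
      using gen[of h H] hc S(3) subgroup_in_lcosets[OF H(1)] by simp
  qed
  then have "generate G F = H"
    using generate_subgroup_incl[OF FH H(1)] by blast
  moreover have "card F \<le> card S * card (lcosets H)"
    unfolding F_def card_cartesian_product[symmetric]
    by (rule card_image_le) (use S(2) H(2) in simp)
  moreover have "finite F"
    unfolding F_def using S(2) H(2) by simp
  ultimately show ?thesis
    using FH that by blast
qed

end

section \<open>Generators and indices along a homomorphism\<close>

context group_hom
begin

text \<open>Up to a factor in the kernel, an element of \<open>K\<close> is a product of lifts of
  generators of the image and of their inverses. Choosing the lifts inside \<open>K\<close> places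
  that factor in \<open>K \<inter> kernel G H h\<close>, which \<open>F2\<close> generates.\<close>

lemma generate_extension:
  assumes "subgroup K G" "F1 \<subseteq> h ` K" "generate H F1 = h ` K"
    and "F2 \<subseteq> K" "generate G F2 = K \<inter> kernel G H h"
  obtains F where "F \<subseteq> K" "finite F1 \<Longrightarrow> finite F2 \<Longrightarrow> finite F"
    "finite F1 \<Longrightarrow> card F \<le> card F1 + card F2" "generate G F = K"
proof -
  define \<tau> where "\<tau> = inv_into K h"
  have \<tau>: "\<tau> a \<in> K" "h (\<tau> a) = a" if "a \<in> F1" for a
    using assms(2) that by (auto simp: \<tau>_def inv_into_into f_inv_into_f)
  define F where "F = \<tau> ` F1 \<union> F2"
  have FK: "F \<subseteq> K"
    using \<tau> assms(4) by (auto simp: F_def)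
  have Kc: "K \<subseteq> carrier G"
    by (rule subgroup.subset[OF assms(1)])
  have F1c: "\<tau> ` F1 \<subseteq> carrier G"
    using FK Kc by (auto simp: F_def)
  have "h ` \<tau> ` F1 = F1"
    using \<tau>(2) by force
  then have img: "h ` generate G (\<tau> ` F1) = h ` K"
    using generate_img[OF F1c] assms(3) by simp
  have gF: "subgroup (generate G F) G"
    by (rule G.generate_is_subgroup) (use FK Kc in blast)
  have mono: "generate G (\<tau> ` F1) \<subseteq> generate G F" "generate G F2 \<subseteq> generate G F"
    by (auto simp: F_def intro!: G.mono_generate)
  have "K \<subseteq> generate G F"
  proof
    fix x assume x: "x \<in> K"
    then obtain g where g: "g \<in> generate G (\<tau> ` F1)" "h g = h x"
      using img by (metis (no_types, lifting) imageE imageI)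
    have gK: "g \<in> K"
      using g(1) G.generate_subgroup_incl[OF _ assms(1), of "\<tau> ` F1"] \<tau>(1) by blast
    have c: "g \<in> carrier G" "x \<in> carrier G"
      using gK x Kc by auto
    have "inv g \<otimes> x \<in> K"
      using gK x assms(1) by (simp add: subgroup.m_closed subgroup.m_inv_closed)
    moreover have "inv g \<otimes> x \<in> kernel G H h"
      using c g(2) by (simp add: kernel_def)
    ultimately have "inv g \<otimes> x \<in> generate G F"
      using assms(5) mono(2) by blast
    then have "g \<otimes> (inv g \<otimes> x) \<in> generate G F"
      using g(1) mono(1) subgroup.m_closed[OF gF] by blast
    then show "x \<in> generate G F"
      using c by (simp add: G.inv_solve_left G.m_assoc[symmetric])
  qed
  then have "generate G F = K"
    using G.generate_subgroup_incl[OF FK assms(1)] by blast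
  moreover have "card F \<le> card F1 + card F2" if "finite F1"
    using card_Un_le[of "\<tau> ` F1" F2] card_image_le[OF that, of \<tau>] by (simp add: F_def)
  moreover have "finite F" if "finite F1" "finite F2"
    using that by (simp add: F_def)
  ultimately show ?thesis
    using that FK by blast
qed

text \<open>A coset of the image and a coset in the kernel are sent to the coset of the product of
  their representatives, the first one lifted through \<open>h\<close>. This is injective: applying
  \<open>h\<close> kills the kernel part and recovers the first coset, and cancelling the lift
  recovers the second.\<close>

lemma index_image_kernel:
  fixes K
  defines "N \<equiv> kernel G H h"
  assumes surj: "h ` carrier G = carrier H" and K: "subgroup K G" "finite (lcosets K)"
  shows "finite (lcosets\<^bsub>H\<^esub> (h ` K))"
    "finite (lcosets\<^bsub>G\<lparr>carrier := N\<rparr>\<^esub> (K \<inter> N))"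
    "card (lcosets\<^bsub>H\<^esub> (h ` K)) * card (lcosets\<^bsub>G\<lparr>carrier := N\<rparr>\<^esub> (K \<inter> N)) \<le> card (lcosets K)"
proof -
  let ?Q = "lcosets\<^bsub>H\<^esub> (h ` K)" and ?R = "lcosets\<^bsub>G\<lparr>carrier := N\<rparr>\<^esub> (K \<inter> N)"
  let ?N = "G\<lparr>carrier := N\<rparr>"
  have N: "subgroup N G"
    unfolding N_def by (rule subgroup_kernel)
  interpret N: group ?N
    by (rule G.subgroup_imp_group[OF N])
  have hK: "subgroup (h ` K) H"
    by (rule subgroup_img_is_subgroup[OF K(1)])
  have KN: "subgroup (K \<inter> N) ?N"
    by (rule G.subgroup_incl) (use G.subgroups_Inter_pair[OF K(1) N] N in auto)
  define \<rho> where "\<rho> C = inv_into (carrier G) h (SOME a. a \<in> C)" for C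
  have \<rho>: "\<rho> C \<in> carrier G" "h (\<rho> C) \<in> C" if "C \<in> ?Q" for C
  proof -
    have "(SOME a. a \<in> C) \<in> C"
      using H.lcosets_nonempty[OF hK that] by (rule someI_ex)
    moreover from this have "(SOME a. a \<in> C) \<in> h ` carrier G"
      using subgroup.lcosets_carrier[OF hK H.is_group that] surj by blast
    ultimately show "\<rho> C \<in> carrier G" "h (\<rho> C) \<in> C"
      by (auto simp: \<rho>_def inv_into_into f_inv_into_f)
  qed
  define \<sigma> where "\<sigma> D = (SOME a. a \<in> D)" for D :: "'a set"
  have \<sigma>_in: "\<sigma> D \<in> D" if "D \<in> ?R" for D
    unfolding \<sigma>_def using N.lcosets_nonempty[OF KN that] by (rule someI_ex)
  have \<sigma>: "\<sigma> D \<in> N" "D = \<sigma> D <#\<^bsub>?N\<^esub> (K \<inter> N)" if "D \<in> ?R" for D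
    using N.lcosets_eq_l_coset[OF KN that \<sigma>_in[OF that]] by auto
  have Nc: "N \<subseteq> carrier G"
    by (rule subgroup.subset[OF N])
  let ?f = "\<lambda>(C, D). (\<rho> C \<otimes> \<sigma> D) <# K"
  have inj: "inj_on ?f (?Q \<times> ?R)"
  proof (rule inj_onI, clarify)
    fix C D C' D'
    assume C: "C \<in> ?Q" "C' \<in> ?Q" and D: "D \<in> ?R" "D' \<in> ?R"
      and eq: "(\<rho> C \<otimes> \<sigma> D) <# K = (\<rho> C' \<otimes> \<sigma> D') <# K"
    have c: "\<rho> C \<in> carrier G" "\<rho> C' \<in> carrier G" "\<sigma> D \<in> carrier G" "\<sigma> D' \<in> carrier G"
      using C D \<rho> \<sigma> Nc by auto
    have "\<rho> C \<otimes> \<sigma> D \<in> (\<rho> C' \<otimes> \<sigma> D') <# K"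
      using G.lcos_self[OF _ K(1)] c eq by blast
    then obtain k where k: "k \<in> K" "\<rho> C \<otimes> \<sigma> D = \<rho> C' \<otimes> \<sigma> D' \<otimes> k"
      by (auto simp: l_coset_def)
    have kc: "k \<in> carrier G"
      using k(1) subgroup.mem_carrier[OF K(1)] by blast
    have one: "h (\<sigma> D) = \<one>\<^bsub>H\<^esub>" "h (\<sigma> D') = \<one>\<^bsub>H\<^esub>"
      using \<sigma>(1)[OF D(1)] \<sigma>(1)[OF D(2)] by (auto simp: N_def kernel_def)
    have "h (\<rho> C) = h (\<rho> C') \<otimes>\<^bsub>H\<^esub> h k"
      using arg_cong[OF k(2), of h] c kc one by simp
    then have "h (\<rho> C) \<in> h (\<rho> C') <#\<^bsub>H\<^esub> (h ` K)"
      using k(1) by (auto simp: l_coset_def)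
    also have "h (\<rho> C') <#\<^bsub>H\<^esub> (h ` K) = C'"
      using H.lcosets_eq_l_coset(2)[OF hK C(2) \<rho>(2)[OF C(2)]] by simp
    finally have "C \<inter> C' \<noteq> {}"
      using \<rho>(2)[OF C(1)] by blast
    then have CC: "C = C'"
      using H.lcos_disjoint[OF hK C] by blast
    have "\<sigma> D = \<sigma> D' \<otimes> k"
      using k(2) c kc unfolding CC by (simp add: G.m_assoc)
    moreover from this have "k = inv (\<sigma> D') \<otimes> \<sigma> D"
      using c kc by (simp add: G.m_assoc[symmetric])
    then have "k \<in> N"
      using \<sigma>(1) D N by (simp add: subgroup.m_closed subgroup.m_inv_closed)
    ultimately have "\<sigma> D \<in> \<sigma> D' <#\<^bsub>?N\<^esub> (K \<inter> N)"
      using k(1) by (auto simp: l_coset_def)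
    then have "\<sigma> D \<in> D'"
      using \<sigma>(2)[OF D(2)] by simp
    then have "D = D'"
      using \<sigma>_in[OF D(1)] N.lcos_disjoint[OF KN D] by blast
    with CC show "C = C' \<and> D = D'" by simp
  qed
  have sub: "?f ` (?Q \<times> ?R) \<subseteq> lcosets K"
  proof clarify
    fix C D assume "C \<in> ?Q" "D \<in> ?R"
    then have "\<rho> C \<otimes> \<sigma> D \<in> carrier G"
      using \<rho>(1) \<sigma>(1) Nc by blast
    then show "(\<rho> C \<otimes> \<sigma> D) <# K \<in> lcosets K"
      unfolding LCOSETS_def by blast
  qed
  have fin: "finite (?Q \<times> ?R)"
    using inj_on_finite[OF inj sub K(2)] .
  \<comment> \<open>Both factors are nonempty, so finiteness of the product passes to each of
    them.\<close>
  have ne: "?Q \<noteq> {}" "?R \<noteq> {}"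
    using H.subgroup_in_lcosets[OF hK] N.subgroup_in_lcosets[OF KN] by blast+
  show "finite ?Q" "finite ?R"
    using finite_cartesian_productD1[OF fin ne(2)] finite_cartesian_productD2[OF fin ne(1)] .
  show "card ?Q * card ?R \<le> card (lcosets K)"
    using card_inj_on_le[OF inj sub K(2)] by (simp add: card_cartesian_product)
qed

end

section \<open>Sublattices\<close>

text \<open>The additive subgroups of \<int>^d, of any rank; closure under differences yields
  negatives and sums.\<close>

definition sublattice :: "(int ^ 'd) set \<Rightarrow> bool" where
  "sublattice L \<longleftrightarrow> 0 \<in> L \<and> (\<forall>v\<in>L. \<forall>w\<in>L. v - w \<in> L)"

lemma sublattice_diff: "sublattice L \<Longrightarrow> v \<in> L \<Longrightarrow> w \<in> L \<Longrightarrow> v - w \<in> L"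
  by (simp add: sublattice_def)

lemma sublattice_add:
  assumes "sublattice L" "v \<in> L" "w \<in> L"
  shows "v + w \<in> L"
proof -
  have "v - (0 - w) \<in> L"
    using assms unfolding sublattice_def by blast
  then show ?thesis by simp
qed

lemma sublattice_scale:
  assumes "sublattice L" "v \<in> L"
  shows "c *s v \<in> L"
proof -
  have nonneg: "int n *s v \<in> L" for n
  proof (induction n)
    case 0
    then show ?case using assms(1) by (simp add: sublattice_def)
  next
    case (Suc n)
    have "int (Suc n) *s v = v + int n *s v"
      by (simp add: vec_eq_iff algebra_simps)
    then show ?case using Suc assms by (simp add: sublattice_add)
  qed
  show ?thesis
  proof (cases "c \<ge> 0")
    case True
    then show ?thesis using nonneg[of "nat c"] by simp
  next
    case False
    have "0 - int (nat (- c)) *s v \<in> L"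
      by (rule sublattice_diff[OF assms(1) _ nonneg]) (use assms(1) in \<open>simp add: sublattice_def\<close>)
    also have "0 - int (nat (- c)) *s v = c *s v"
      using False by (simp add: vec_eq_iff)
    finally show ?thesis .
  qed
qed

lemma sublattice_sum:
  assumes "sublattice L" "\<And>i. i \<in> I \<Longrightarrow> f i \<in> L"
  shows "sum f I \<in> L"
  using assms(2)
  by (induction I rule: infinite_finite_induct)
    (use assms(1) in \<open>auto simp: sublattice_add\<close>, auto simp: sublattice_def)

text \<open>Induction on the coordinates allowed to be nonzero: each costs at most one generator, a
  vector whose coordinate \<open>j\<close> is nonzero of least absolute value. Generation is phrased
  through all sublattices \<open>K\<close> above \<open>F\<close> so that it applies directly to the
  translations in a generated subgroup.\<close>

lemma sublattice_generators_support:
  assumes "finite T" "sublattice L" "\<And>v i. v \<in> L \<Longrightarrow> i \<notin> T \<Longrightarrow> v $ i = 0"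
  shows "\<exists>F\<subseteq>L. finite F \<and> card F \<le> card T \<and> (\<forall>K. sublattice K \<longrightarrow> F \<subseteq> K \<longrightarrow> L \<subseteq> K)"
  using assms
proof (induction T arbitrary: L rule: finite_induct)
  case empty
  then have "L \<subseteq> {0}"
    by (auto simp: vec_eq_iff)
  then show ?case
    by (intro exI[of _ "{}"]) (auto simp: sublattice_def)
next
  case (insert j T)
  define L0 where "L0 = {v \<in> L. v $ j = 0}"
  have "sublattice L0"
    using insert.prems(1) by (auto simp: L0_def sublattice_def)
  moreover have "v $ i = 0" if "v \<in> L0" "i \<notin> T" for v i
    using that insert.prems(2)[of v i] by (cases "i = j") (auto simp: L0_def)
  ultimately obtain F where F: "F \<subseteq> L0" "finite F" "card F \<le> card T"
    "\<And>K. sublattice K \<Longrightarrow> F \<subseteq> K \<Longrightarrow> L0 \<subseteq> K"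
    using insert.IH[of L0] by blast
  show ?case
  proof (cases "L0 = L")
    case True
    then show ?thesis
      using F insert.hyps by (intro exI[of _ F]) (auto simp: L0_def)
  next
    case False
    then have "\<exists>u. u \<in> L \<and> u $ j \<noteq> 0" by (auto simp: L0_def)
    from ex_has_least_nat[of "\<lambda>u. u \<in> L \<and> u $ j \<noteq> 0" _ "\<lambda>u. nat \<bar>u $ j\<bar>"] this
    obtain u where u: "u \<in> L" "u $ j \<noteq> 0"
      and min: "\<And>w. w \<in> L \<Longrightarrow> w $ j \<noteq> 0 \<Longrightarrow> nat \<bar>u $ j\<bar> \<le> nat \<bar>w $ j\<bar>"
      by blast
    have "L \<subseteq> K" if K: "sublattice K" "insert u F \<subseteq> K" for K
    proof
      fix v assume v: "v \<in> L"
      \<comment> \<open>Division with remainder in coordinate \<open>j\<close>: the remainder is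
        smaller than \<open>u $ j\<close> in absolute value, so minimality of \<open>u\<close>
        forces it to be 0.\<close>
      define w where "w = v - (v $ j div u $ j) *s u"
      have w: "w \<in> L"
        using v u(1) insert.prems(1) by (simp add: w_def sublattice_diff sublattice_scale)
      have wj: "w $ j = v $ j mod u $ j"
        by (simp add: w_def minus_div_mult_eq_mod)
      have "w $ j = 0"
      proof (rule ccontr)
        assume "w $ j \<noteq> 0"
        with min[OF w] have "\<bar>u $ j\<bar> \<le> \<bar>w $ j\<bar>" by simp
        with abs_mod_less[OF u(2), of "v $ j"] show False by (simp add: wj)
      qed
      then have "w \<in> K"
        using F(4)[of K] K w by (auto simp: L0_def)
      then have "w + (v $ j div u $ j) *s u \<in> K"
        using K by (simp add: sublattice_add sublattice_scale)
      then show "v \<in> K" by (simp add: w_def)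
    qed
    moreover have "insert u F \<subseteq> L"
      using F(1) u(1) by (auto simp: L0_def)
    moreover have "card (insert u F) \<le> card (insert j T)"
      using F(2,3) insert.hyps by (simp add: card_insert_if)
    ultimately show ?thesis
      using F(2) by (intro exI[of _ "insert u F"]) auto
  qed
qed

lemma sublattice_generators:
  fixes L :: "(int ^ 'd) set"
  assumes "sublattice L"
  obtains F where "F \<subseteq> L" "finite F" "card F \<le> CARD('d)"
    "\<And>K. sublattice K \<Longrightarrow> F \<subseteq> K \<Longrightarrow> L \<subseteq> K"
  using sublattice_generators_support[of UNIV L] assms by auto

section \<open>The rank of finite index subgroups\<close>

lemma semidirect_int_simps [simp]:
  "(A, v) \<in> carrier (semidirect_int \<Lambda>) \<longleftrightarrow> A \<in> \<Lambda>"
  "(A, v) \<otimes>\<^bsub>semidirect_int \<Lambda>\<^esub> (B, w) = (A ** B, v + A *v w)"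
  "\<one>\<^bsub>semidirect_int \<Lambda>\<^esub> = (mat 1, 0)"
  by (simp_all add: semidirect_int_def)

locale affine_group =
  fixes \<Lambda> :: "(int ^ 'd ^ 'd) set"
  assumes finite_index: "finite_index_subgroup \<Lambda> SL_int"
begin

abbreviation "\<Gamma> \<equiv> semidirect_int \<Lambda>"
abbreviation "\<Lambda>g \<equiv> SL_int\<lparr>carrier := \<Lambda>\<rparr>"

lemma \<Lambda>: "subgroup \<Lambda> SL_int"
  using finite_index by (simp add: finite_index_subgroup_def)

sublocale group \<Gamma>
  by (rule group_semidirect_int[OF \<Lambda>])

lemma one_\<Lambda>: "mat 1 \<in> \<Lambda>"
  using subgroup.one_closed[OF \<Lambda>] by (simp add: SL_int_simps)

lemma inv_translation: "inv\<^bsub>\<Gamma>\<^esub> (mat 1, v) = (mat 1, - v)"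
  by (rule inv_equality) (auto simp: one_\<Lambda>)

sublocale linear_part: group_hom \<Gamma> \<Lambda>g fst
proof (intro group_hom.intro group_hom_axioms.intro)
  interpret SL: group "SL_int :: (int ^ 'd ^ 'd) monoid" by (rule group_SL_int)
  interpret group \<Lambda>g by (rule SL.subgroup_imp_group[OF \<Lambda>])
  show "group \<Lambda>g" by (rule is_group)
  show "group \<Gamma>" by (rule group_semidirect_int[OF \<Lambda>])
  show "fst \<in> hom \<Gamma> \<Lambda>g"
    by (rule homI) (auto simp: semidirect_int_def SL_int_def)
qed

lemma linear_part_surj: "fst ` carrier \<Gamma> = carrier \<Lambda>g"
  by (auto simp: semidirect_int_def)

lemma linear_part_kernel: "kernel \<Gamma> \<Lambda>g fst = translation_subgroup"
  by (auto simp: kernel_def translation_subgroup_def semidirect_int_def SL_int_def one_\<Lambda>)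

lemma sublattice_translations:
  assumes "subgroup H \<Gamma>"
  shows "sublattice {v. (mat 1, v) \<in> H}"
proof -
  have "(mat 1, v - w) \<in> H" if "(mat 1, v) \<in> H" "(mat 1, w) \<in> H" for v w
    using subgroup.m_closed[OF assms that(1) subgroup.m_inv_closed[OF assms that(2)]]
    by (simp add: inv_translation)
  moreover have "(mat 1, 0) \<in> H"
    using subgroup.one_closed[OF assms] by simp
  ultimately show ?thesis
    by (simp add: sublattice_def)
qed

text \<open>Schreier's lemma is used twice: once in \<open>SL_int\<close>, for a finite generating
  set \<open>S\<close> of \<open>\<Lambda>\<close>, and once in \<open>\<Lambda>\<close>, for the
  linear part of \<open>H\<close>. The constant is \<open>card S\<close>, hence the same for all
  \<open>H\<close>.\<close>

lemma subgroup_generators: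
  obtains c where "\<And>H. finite_index_subgroup H \<Gamma> \<Longrightarrow>
    \<exists>F\<subseteq>H. finite F \<and> generate \<Gamma> F = H \<and>
      card F \<le> c * card (lcosets\<^bsub>\<Lambda>g\<^esub> (fst ` H)) + CARD('d)"
proof -
  interpret SL: group "SL_int :: (int ^ 'd ^ 'd) monoid" by (rule group_SL_int)
  have "finite (transvections :: (int ^ 'd ^ 'd) set)"
    by simp
  then obtain S where S: "S \<subseteq> \<Lambda>" "finite S" "generate SL_int S = \<Lambda>"
    using SL.schreier[OF transvections_subset _ SL_int_generated \<Lambda>] finite_index
    unfolding finite_index_subgroup_def by metis
  have S': "S \<subseteq> carrier \<Lambda>g" "generate \<Lambda>g S = carrier \<Lambda>g"
    using S SL.generate_consistent[OF S(1) \<Lambda>] by simp_all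
  have "\<exists>F\<subseteq>H. finite F \<and> generate \<Gamma> F = H \<and>
      card F \<le> card S * card (lcosets\<^bsub>\<Lambda>g\<^esub> (fst ` H)) + CARD('d)"
    if "finite_index_subgroup H \<Gamma>" for H
  proof -
    have H: "subgroup H \<Gamma>" "finite (lcosets\<^bsub>\<Gamma>\<^esub> H)"
      using that by (auto simp: finite_index_subgroup_def)
    have "subgroup (fst ` H) \<Lambda>g"
      by (rule linear_part.subgroup_img_is_subgroup[OF H(1)])
    then obtain F1 where F1: "F1 \<subseteq> fst ` H" "finite F1" "generate \<Lambda>g F1 = fst ` H"
      "card F1 \<le> card S * card (lcosets\<^bsub>\<Lambda>g\<^esub> (fst ` H))"
      using linear_part.H.schreier[OF S'(1) S(2) S'(2)]
        linear_part.index_image_kernel(1)[OF linear_part_surj H] by metis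
    let ?L = "{v. (mat 1, v) \<in> H}"
    obtain F0 where F0: "F0 \<subseteq> ?L" "finite F0" "card F0 \<le> CARD('d)"
      "\<And>K. sublattice K \<Longrightarrow> F0 \<subseteq> K \<Longrightarrow> ?L \<subseteq> K"
      using sublattice_generators[OF sublattice_translations[OF H(1)]] by metis
    define F2 where "F2 = Pair (mat 1 :: int ^ 'd ^ 'd) ` F0"
    have F2: "F2 \<subseteq> H \<inter> translation_subgroup"
      using F0(1) by (auto simp: F2_def translation_subgroup_def)
    have HT: "subgroup (H \<inter> translation_subgroup) \<Gamma>"
      by (rule subgroups_Inter_pair[OF H(1) subgroup_translation_subgroup[OF \<Lambda>]])
    have "subgroup (generate \<Gamma> F2) \<Gamma>"
      by (rule generate_is_subgroup) (use F2 subgroup.subset[OF HT] in blast)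
    \<comment> \<open>The translations in the generated subgroup form a sublattice containing
      \<open>F0\<close>, hence containing \<open>?L\<close>.\<close>
    then have "?L \<subseteq> {v. (mat 1, v) \<in> generate \<Gamma> F2}"
      by (intro F0(4) sublattice_translations) (auto simp: F2_def intro: generate.incl)
    then have "H \<inter> translation_subgroup \<subseteq> generate \<Gamma> F2"
      by (auto simp: translation_subgroup_def)
    then have gF2: "generate \<Gamma> F2 = H \<inter> kernel \<Gamma> \<Lambda>g fst"
      using generate_subgroup_incl[OF F2 HT] by (auto simp: linear_part_kernel)
    have fin2: "finite F2" "card F2 \<le> CARD('d)"
      using F0(2,3) card_image_le[OF F0(2), of "Pair (mat 1 :: int ^ 'd ^ 'd)"] by (auto simp: F2_def)
    obtain F where "F \<subseteq> H" "finite F" "card F \<le> card F1 + card F2" "generate \<Gamma> F = H"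
    proof (rule linear_part.generate_extension[OF H(1) F1(1,3) _ gF2])
      show "F2 \<subseteq> H" using F2 by simp
    qed (use F1(2) fin2(1) in simp)
    then show ?thesis
      using F1(4) fin2(2) by (intro exI[of _ F]) auto
  qed
  then show ?thesis
    using that by blast
qed

lemma index_bound:
  assumes "finite_index_subgroup H \<Gamma>"
  shows "card (lcosets\<^bsub>\<Lambda>g\<^esub> (fst ` H)) > 0"
    "card (lcosets\<^bsub>\<Lambda>g\<^esub> (fst ` H)) *
        group_index (\<Gamma>\<lparr>carrier := translation_subgroup\<rparr>) (H \<inter> translation_subgroup)
      \<le> group_index \<Gamma> H"
proof -
  have H: "subgroup H \<Gamma>" "finite (lcosets\<^bsub>\<Gamma>\<^esub> H)"
    using assms by (auto simp: finite_index_subgroup_def)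
  have "subgroup (fst ` H) \<Lambda>g"
    by (rule linear_part.subgroup_img_is_subgroup[OF H(1)])
  from linear_part.H.subgroup_in_lcosets[OF this]
  show "card (lcosets\<^bsub>\<Lambda>g\<^esub> (fst ` H)) > 0"
    using linear_part.index_image_kernel(1)[OF linear_part_surj H] by (auto simp: card_gt_0_iff)
  show "card (lcosets\<^bsub>\<Lambda>g\<^esub> (fst ` H)) *
        group_index (\<Gamma>\<lparr>carrier := translation_subgroup\<rparr>) (H \<inter> translation_subgroup)
      \<le> group_index \<Gamma> H"
    using linear_part.index_image_kernel(3)[OF linear_part_surj H]
    by (simp add: group_index_def linear_part_kernel)
qed

lemma group_rank_le:
  assumes "subgroup H \<Gamma>" "F \<subseteq> H" "finite F" "generate \<Gamma> F = H"
  shows "group_rank (\<Gamma>\<lparr>carrier := H\<rparr>) \<le> enat (card F)"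
  unfolding group_rank_def
  by (rule INF_lower) (use assms generate_consistent[OF assms(2,1)] in simp)

lemma rank_gradient:
  assumes \<Gamma>s: "\<And>n. finite_index_subgroup (\<Gamma>s n) \<Gamma>"
    and index: "filterlim
        (\<lambda>n. group_index (\<Gamma>\<lparr>carrier := translation_subgroup\<rparr>) (\<Gamma>s n \<inter> translation_subgroup))
        at_top sequentially"
  shows "(\<lambda>n. (ereal_of_enat (group_rank (\<Gamma>\<lparr>carrier := \<Gamma>s n\<rparr>)) - 1)
            / ereal (real (group_index \<Gamma> (\<Gamma>s n)))) \<longlonglongrightarrow> 0"
proof -
  define I where "I n = group_index (\<Gamma>\<lparr>carrier := translation_subgroup\<rparr>) (\<Gamma>s n \<inter> translation_subgroup)" for n
  define N where "N n = group_index \<Gamma> (\<Gamma>s n)" for n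
  define k where "k n = card (lcosets\<^bsub>\<Lambda>g\<^esub> (fst ` \<Gamma>s n))" for n
  obtain c where c: "\<And>H. finite_index_subgroup H \<Gamma> \<Longrightarrow>
    \<exists>F\<subseteq>H. finite F \<and> generate \<Gamma> F = H \<and>
      card F \<le> c * card (lcosets\<^bsub>\<Lambda>g\<^esub> (fst ` H)) + CARD('d)"
    using subgroup_generators by blast
  have "\<exists>r. group_rank (\<Gamma>\<lparr>carrier := \<Gamma>s n\<rparr>) = enat r \<and> r \<le> c * k n + CARD('d)" for n
  proof -
    obtain F where F: "F \<subseteq> \<Gamma>s n" "finite F" "generate \<Gamma> F = \<Gamma>s n" "card F \<le> c * k n + CARD('d)"
      using c[OF \<Gamma>s[of n]] by (auto simp: k_def)
    have "group_rank (\<Gamma>\<lparr>carrier := \<Gamma>s n\<rparr>) \<le> enat (card F)"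
      by (rule group_rank_le) (use F \<Gamma>s[of n] in \<open>auto simp: finite_index_subgroup_def\<close>)
    then show ?thesis
      using F(4) by (cases "group_rank (\<Gamma>\<lparr>carrier := \<Gamma>s n\<rparr>)") auto
  qed
  then obtain r where r: "\<And>n. group_rank (\<Gamma>\<lparr>carrier := \<Gamma>s n\<rparr>) = enat (r n)"
    "\<And>n. r n \<le> c * k n + CARD('d)"
    by metis
  \<comment> \<open>Since \<open>k n \<ge> 1\<close>, the numerator is at most
    \<open>(c + CARD('d) + 1) * k n\<close> in absolute value, the last 1 absorbing the -1. The
    factor \<open>k n\<close> then cancels against \<open>k n * I n \<le> N n\<close>.\<close>
  have bound: "\<bar>(real (r n) - 1) / real (N n)\<bar> \<le> (real c + real CARD('d) + 1) / real (I n)"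
    if I: "I n > 0" for n
  proof -
    have k: "k n > 0" and N: "k n * I n \<le> N n"
      using index_bound[OF \<Gamma>s[of n]] by (auto simp: k_def I_def N_def)
    have "\<bar>real (r n) - 1\<bar> \<le> real (r n) + 1" by simp
    also have "\<dots> \<le> real (c * k n + CARD('d)) + 1"
      using r(2)[of n] by (simp only: of_nat_le_iff add_le_cancel_right)
    also have "\<dots> \<le> (real c + real CARD('d) + 1) * real (k n)"
      using mult_left_mono[of 1 "real (k n)" "real CARD('d) + 1"] k by (simp add: algebra_simps)
    finally have "\<bar>real (r n) - 1\<bar> \<le> (real c + real CARD('d) + 1) * real (k n)" .
    then have "\<bar>(real (r n) - 1) / real (N n)\<bar> \<le> (real c + real CARD('d) + 1) * real (k n) / real (N n)"
      by (simp add: divide_right_mono)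
    also have "\<dots> \<le> (real c + real CARD('d) + 1) * real (k n) / real (k n * I n)"
      using N k I by (intro divide_left_mono) (auto simp only: of_nat_le_iff, auto simp: order.strict_trans2[OF _ N])
    also have "\<dots> = (real c + real CARD('d) + 1) / real (I n)"
      using k by simp
    finally show ?thesis .
  qed
  have I_lim: "filterlim (\<lambda>n. real (I n)) at_top sequentially"
    using filterlim_compose[OF filterlim_real_sequentially index] by (simp add: I_def)
  have "(\<lambda>n. (real c + real CARD('d) + 1) / real (I n)) \<longlonglongrightarrow> 0"
    by (rule real_tendsto_divide_at_top[OF tendsto_const I_lim])
  moreover have "\<forall>\<^sub>F n in sequentially. norm ((real (r n) - 1) / real (N n)) \<le> (real c + real CARD('d) + 1) / real (I n)"
    using filterlim_at_top_dense[THEN iffD1, OF I_lim, rule_format, of 0]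
    by eventually_elim (use bound in auto)
  ultimately have "(\<lambda>n. (real (r n) - 1) / real (N n)) \<longlonglongrightarrow> 0"
    by (rule Lim_null_comparison[rotated])
  then have lim: "(\<lambda>n. ereal ((real (r n) - 1) / real (N n))) \<longlonglongrightarrow> 0"
    by (simp add: zero_ereal_def)
  \<comment> \<open>With a finite rank and a positive index, the quotient of extended reals is a
    quotient of reals.\<close>
  have "N n > 0" for n
  proof -
    have "subgroup (\<Gamma>s n) \<Gamma>" "finite (lcosets\<^bsub>\<Gamma>\<^esub> (\<Gamma>s n))"
      using \<Gamma>s[of n] by (auto simp: finite_index_subgroup_def)
    with subgroup_in_lcosets show ?thesis
      by (auto simp: N_def group_index_def card_gt_0_iff)
  qed
  then have "(ereal_of_enat (group_rank (\<Gamma>\<lparr>carrier := \<Gamma>s n\<rparr>)) - 1) / ereal (real (N n)) =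
      ereal ((real (r n) - 1) / real (N n))" for n
    by (simp add: r(1) one_ereal_def del: ereal_eq_1)
  then show ?thesis
    using lim by (simp add: N_def)
qed

end

section \<open>Finite actions with many fixed points\<close>

text \<open>Bonferroni's inequality: a new set overlaps the union of the earlier ones in at most the
  sum of its pairwise intersections with them.\<close>

lemma sum_card_le_card_UN:
  fixes k :: nat
  assumes "\<And>t. t < k \<Longrightarrow> finite (A t)"
  shows "(\<Sum>t<k. card (A t)) \<le> card (\<Union>t<k. A t) + (\<Sum>t<k. \<Sum>s<t. card (A s \<inter> A t))"
  using assms
proof (induction k)
  case (Suc k)
  let ?B = "\<Union>t<k. A t"
  have "?B \<inter> A k = (\<Union>s<k. A s \<inter> A k)"
    by blast
  then have "card (?B \<inter> A k) \<le> (\<Sum>s<k. card (A s \<inter> A k))"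
    using card_UN_le[of "{..<k}" "\<lambda>s. A s \<inter> A k"] by simp
  moreover have "card ?B + card (A k) = card (?B \<union> A k) + card (?B \<inter> A k)"
    by (rule card_Un_Int) (use Suc.prems in auto)
  moreover have "(\<Union>t<Suc k. A t) = ?B \<union> A k"
    by (auto simp: less_Suc_eq)
  ultimately show ?case
    using Suc by simp
qed simp

text \<open>Take \<open>k\<close> with \<open>k * \<epsilon> \<ge> 2\<close>. If all pairwise
  intersections were small, Bonferroni's inequality would bound a total size of at least
  \<open>2 * card X\<close> by \<open>3 / 2 * card X\<close>. Both \<open>k\<close> and
  \<open>\<delta>\<close> are chosen before \<open>X\<close>.\<close>

lemma dense_sets_intersect:
  fixes \<epsilon> :: real
  assumes "\<epsilon> > 0"
  shows "\<exists>(k :: nat) (\<delta> :: real). \<delta> > 0 \<and> (\<forall>(X :: 'x set) A. finite X \<longrightarrow> X \<noteq> {} \<longrightarrow> (\<forall>t<k. A t \<subseteq> X) \<longrightarrow>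
      (\<forall>t<k. \<epsilon> * card X \<le> card (A t)) \<longrightarrow>
      (\<exists>s t. s < t \<and> t < k \<and> \<delta> * card X \<le> card (A s \<inter> A t)))"
proof -
  define k where "k = nat \<lceil>2 / \<epsilon>\<rceil>"
  have "2 / \<epsilon> \<le> real k"
    unfolding k_def by (rule real_nat_ceiling_ge)
  then have k: "2 \<le> real k * \<epsilon>"
    using assms by (simp add: pos_divide_le_eq)
  then have k0: "k > 0"
    by (intro gr0I) auto
  \<comment> \<open>Chosen so that \<open>k * k\<close> intersections of density
    \<open>\<delta>\<close> contribute \<open>card X / 2\<close>.\<close>
  define \<delta> where "\<delta> = 1 / (2 * real k * real k)"
  have "\<delta> > 0"
    using k0 by (simp add: \<delta>_def)
  moreover have "\<exists>s t. s < t \<and> t < k \<and> \<delta> * card X \<le> card (A s \<inter> A t)"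
    if X: "finite X" "X \<noteq> {}" and A: "\<forall>t<k. A t \<subseteq> X" "\<forall>t<k. \<epsilon> * card X \<le> card (A t)"
    for X :: "'x set" and A
  proof (rule ccontr)
    assume neg: "\<not> ?thesis"
    have le: "real (card (A s \<inter> A t)) \<le> \<delta> * card X" if "s < t" "t < k" for s t
      using neg that by (meson le_cases)
    have "real k * \<epsilon> * card X = (\<Sum>t<k. \<epsilon> * card X)"
      by simp
    also have "\<dots> \<le> real (\<Sum>t<k. card (A t))"
      unfolding of_nat_sum by (rule sum_mono) (use A(2) in simp)
    also have "\<dots> \<le> real (card (\<Union>t<k. A t) + (\<Sum>t<k. \<Sum>s<t. card (A s \<inter> A t)))"
      by (intro of_nat_mono sum_card_le_card_UN) (use A(1) X(1) finite_subset in blast)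
    also have "\<dots> = real (card (\<Union>t<k. A t)) + (\<Sum>t<k. \<Sum>s<t. real (card (A s \<inter> A t)))"
      by simp
    also have "\<dots> \<le> real (card X) + (\<Sum>t<k. real k * (\<delta> * card X))"
    proof (intro add_mono sum_mono)
      show "real (card (\<Union>t<k. A t)) \<le> real (card X)"
        using A(1) by (intro of_nat_mono card_mono[OF X(1)]) auto
      fix t assume t: "t \<in> {..<k}"
      have "(\<Sum>s<t. real (card (A s \<inter> A t))) \<le> (\<Sum>s<t. \<delta> * card X)"
        by (rule sum_mono) (use le t in simp)
      also have "\<dots> = real t * (\<delta> * card X)"
        by simp
      also have "\<dots> \<le> real k * (\<delta> * card X)"
        using t \<open>\<delta> > 0\<close> by (intro mult_right_mono) auto
      finally show "(\<Sum>s<t. real (card (A s \<inter> A t))) \<le> real k * (\<delta> * card X)" .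
    qed
    also have "\<dots> = 3 / 2 * card X"
      using k0 by (simp add: \<delta>_def field_simps)
    finally have "real k * \<epsilon> * card X \<le> 3 / 2 * card X" .
    moreover have "2 * real (card X) \<le> real k * \<epsilon> * card X"
      using k by (intro mult_right_mono) auto
    moreover have "real (card X) > 0"
      using X by (simp add: card_gt_0_iff)
    ultimately show False by linarith
  qed
  ultimately show ?thesis
    by blast
qed

definition fixed_points :: "'x set \<Rightarrow> ('g \<Rightarrow> 'x \<Rightarrow> 'x) \<Rightarrow> 'g set \<Rightarrow> 'x set" where
  "fixed_points X \<phi> S = {x \<in> X. \<forall>g\<in>S. \<phi> g x = x}"

text \<open>A positive density of fixed points of \<open>S\<close> forces one of \<open>F c\<close>. The quantifiers make \<open>c\<close> and
  \<open>\<delta>\<close> uniform over all finite actions, so that below \<open>c\<close> bounds the index of every subgroup of the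
  sequence at once.\<close>

definition forces ::
  "'x itself \<Rightarrow> ('g, 'b) monoid_scheme \<Rightarrow> 'g set \<Rightarrow> (int \<Rightarrow> 'g set) \<Rightarrow> bool" where
  "forces _ G S F \<longleftrightarrow> (\<forall>\<epsilon>>0. \<exists>c>0. \<exists>\<delta>>0. \<forall>(X :: 'x set) \<phi>.
     group_action G X \<phi> \<longrightarrow> finite X \<longrightarrow> X \<noteq> {} \<longrightarrow>
     \<epsilon> * real (card X) \<le> real (card (fixed_points X \<phi> S)) \<longrightarrow>
     \<delta> * real (card X) \<le> real (card (fixed_points X \<phi> (F c))))"

text \<open>The density \<open>\<delta>\<close> from the first step is the \<open>\<epsilon>\<close>
  of the second. The second hypothesis ranges over all \<open>c > 0\<close> because the first step
  determines \<open>c\<close> only after \<open>\<epsilon>\<close> is given.\<close>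

lemma forces_trans:
  assumes "forces TYPE('x) G S F" "\<And>c. c > 0 \<Longrightarrow> forces TYPE('x) G (F c) F'"
  shows "forces TYPE('x) G S F'"
  unfolding forces_def
proof (intro allI impI)
  fix \<epsilon> :: real assume "\<epsilon> > 0"
  then obtain c \<delta> where c: "c > 0" "\<delta> > 0" and 1: "\<And>(X :: 'x set) \<phi>. group_action G X \<phi> \<Longrightarrow> finite X \<Longrightarrow> X \<noteq> {} \<Longrightarrow>
     \<epsilon> * real (card X) \<le> real (card (fixed_points X \<phi> S)) \<Longrightarrow>
     \<delta> * real (card X) \<le> real (card (fixed_points X \<phi> (F c)))"
    using assms(1) unfolding forces_def by meson
  obtain c' \<delta>' where c': "c' > 0" "\<delta>' > 0" and 2: "\<And>(X :: 'x set) \<phi>. group_action G X \<phi> \<Longrightarrow> finite X \<Longrightarrow> X \<noteq> {} \<Longrightarrow>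
     \<delta> * real (card X) \<le> real (card (fixed_points X \<phi> (F c))) \<Longrightarrow>
     \<delta>' * real (card X) \<le> real (card (fixed_points X \<phi> (F' c')))"
    using assms(2)[OF c(1)] c(2) unfolding forces_def by meson
  show "\<exists>c>0. \<exists>\<delta>>0. \<forall>(X :: 'x set) \<phi>. group_action G X \<phi> \<longrightarrow> finite X \<longrightarrow> X \<noteq> {} \<longrightarrow>
     \<epsilon> * real (card X) \<le> real (card (fixed_points X \<phi> S)) \<longrightarrow>
     \<delta> * real (card X) \<le> real (card (fixed_points X \<phi> (F' c)))"
    using c' 1 2 by blast
qed

text \<open>Stabilizers are subgroups, so each fixed point of \<open>S\<close> is fixed by
  \<open>F c\<close>; no density is lost and one \<open>c\<close> serves every
  \<open>\<epsilon>\<close>.\<close>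

lemma (in group) forces_generated:
  assumes "S \<subseteq> carrier G" "c > 0" "\<And>K. subgroup K G \<Longrightarrow> S \<subseteq> K \<Longrightarrow> F c \<subseteq> K"
  shows "forces TYPE('x) G S F"
proof -
  have "fixed_points X \<phi> S \<subseteq> fixed_points X \<phi> (F c)" if "group_action G X \<phi>" for X :: "'x set" and \<phi>
  proof
    interpret group_action G X \<phi> by fact
    fix x assume x: "x \<in> fixed_points X \<phi> S"
    then have "subgroup (stabilizer G \<phi> x) G" "S \<subseteq> stabilizer G \<phi> x"
      using assms(1) by (auto simp: fixed_points_def stabilizer_def intro!: stabilizer_subgroup[unfolded stabilizer_def])
    then have "F c \<subseteq> stabilizer G \<phi> x"
      by (rule assms(3))
    then show "x \<in> fixed_points X \<phi> (F c)"
      using x by (auto simp: fixed_points_def stabilizer_def)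
  qed
  then have "real (card (fixed_points X \<phi> S)) \<le> real (card (fixed_points X \<phi> (F c)))"
    if "group_action G X \<phi>" "finite X" for X :: "'x set" and \<phi>
    using that by (intro of_nat_mono card_mono) (auto simp: fixed_points_def)
  then show ?thesis
    unfolding forces_def using assms(2) by (meson order_trans)
qed

text \<open>The fixed points of \<open>S\<close> and of its conjugates by \<open>h 0, h 1, \<dots>\<close> have the same density, so two of
  these sets meet in a set of positive density.\<close>

lemma (in group) forces_conjugates:
  fixes h :: "nat \<Rightarrow> 'a"
  assumes S: "S \<subseteq> carrier G" and h: "\<And>t. h t \<in> carrier G"
    and F: "\<And>k. \<exists>c>0. \<forall>s t K. s < t \<longrightarrow> t < k \<longrightarrow> subgroup K G \<longrightarrow>
      (\<forall>g\<in>S. h s \<otimes> g \<otimes> inv (h s) \<in> K \<and> h t \<otimes> g \<otimes> inv (h t) \<in> K) \<longrightarrow> F c \<subseteq> K"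
  shows "forces TYPE('x) G S F"
  unfolding forces_def
proof (intro allI impI)
  fix \<epsilon> :: real assume "\<epsilon> > 0"
  obtain k :: nat and \<delta> :: real where \<delta>: "\<delta> > 0" and pair:
    "\<forall>(X :: 'x set) A. finite X \<longrightarrow> X \<noteq> {} \<longrightarrow> (\<forall>t<k. A t \<subseteq> X) \<longrightarrow>
      (\<forall>t<k. \<epsilon> * card X \<le> card (A t)) \<longrightarrow>
      (\<exists>s t. s < t \<and> t < k \<and> \<delta> * card X \<le> card (A s \<inter> A t))"
    using dense_sets_intersect[where 'x = 'x, OF \<open>\<epsilon> > 0\<close>] by (elim exE conjE) (rule that)
  obtain c where c: "c > 0" "\<And>s t K. s < t \<Longrightarrow> t < k \<Longrightarrow> subgroup K G \<Longrightarrow>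
      (\<forall>g\<in>S. h s \<otimes> g \<otimes> inv (h s) \<in> K \<and> h t \<otimes> g \<otimes> inv (h t) \<in> K) \<Longrightarrow> F c \<subseteq> K"
    using F[of k] by blast
  have "\<delta> * real (card X) \<le> real (card (fixed_points X \<phi> (F c)))"
    if X: "group_action G X \<phi>" "finite X" "X \<noteq> {}"
      and dense: "\<epsilon> * real (card X) \<le> real (card (fixed_points X \<phi> S))" for X :: "'x set" and \<phi>
  proof -
    interpret group_action G X \<phi> by (rule X(1))
    define A where "A t = \<phi> (h t) ` fixed_points X \<phi> S" for t
    have A: "A t \<subseteq> X" for t
      using element_image[OF h[of t]] by (auto simp: A_def fixed_points_def)
    have "card (A t) = card (fixed_points X \<phi> S)" for t
      unfolding A_def
      by (rule card_image) (rule inj_on_subset[OF inj_prop[OF h]], auto simp: fixed_points_def)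
    with pair[rule_format, of X A] X A dense obtain s t where st: "s < t" "t < k"
      "\<delta> * card X \<le> card (A s \<inter> A t)"
      by auto
    have conj: "h t \<otimes> g \<otimes> inv (h t) \<in> stabilizer G \<phi> x" if x: "x \<in> A t" and g: "g \<in> S" for x g t
    proof -
      obtain y where y: "y \<in> X" "\<phi> g y = y" "x = \<phi> (h t) y"
        using x g by (auto simp: A_def fixed_points_def)
      have gc: "g \<in> carrier G" using g S by blast
      have "\<phi> (inv (h t)) x = y"
        using orbit_sym_aux[OF h y(1)] y(3) by simp
      moreover have "x \<in> X" using x A by blast
      ultimately have "\<phi> (h t \<otimes> g \<otimes> inv (h t)) x = x"
        using y gc h[of t] by (simp add: composition_rule)
      then show ?thesis
        using gc h[of t] by (simp add: stabilizer_def)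
    qed
    have "A s \<inter> A t \<subseteq> fixed_points X \<phi> (F c)"
    proof
      fix x assume x: "x \<in> A s \<inter> A t"
      then have xX: "x \<in> X" using A by blast
      \<comment> \<open>The stabilizer of \<open>x\<close> contains the conjugates of
        \<open>S\<close> by \<open>h s\<close> and by \<open>h t\<close>, so it can take the place
        of \<open>K\<close> in the algebraic hypothesis.\<close>
      have "F c \<subseteq> stabilizer G \<phi> x"
        by (rule c(2)[OF st(1,2) stabilizer_subgroup[OF xX]]) (use conj x in blast)
      then show "x \<in> fixed_points X \<phi> (F c)"
        using xX by (auto simp: fixed_points_def stabilizer_def)
    qed
    then have "card (A s \<inter> A t) \<le> card (fixed_points X \<phi> (F c))"
      using X(2) by (intro card_mono) (auto simp: fixed_points_def)
    then show ?thesis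
      using st(3) by linarith
  qed
  then show "\<exists>c>0. \<exists>\<delta>>0. \<forall>(X :: 'x set) \<phi>. group_action G X \<phi> \<longrightarrow> finite X \<longrightarrow> X \<noteq> {} \<longrightarrow>
     \<epsilon> * real (card X) \<le> real (card (fixed_points X \<phi> S)) \<longrightarrow>
     \<delta> * real (card X) \<le> real (card (fixed_points X \<phi> (F c)))"
    using c(1) \<delta> by blast
qed

section \<open>Transvections in finite index subgroups and common multiples\<close>

lemma transvection_in_finite_index:
  assumes "finite_index_subgroup \<Lambda> SL_int" "i \<noteq> j"
  obtains m :: int where "m > 0" "\<And>t :: nat. transvection i j (m * int t) \<in> \<Lambda>"
proof -
  interpret group "SL_int :: (int ^ 'a ^ 'a) monoid" by (rule group_SL_int)
  have \<Lambda>: "subgroup \<Lambda> SL_int" and fin: "finite (lcosets\<^bsub>SL_int\<^esub> \<Lambda>)"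
    using assms(1) by (auto simp: finite_index_subgroup_def)
  let ?T = "\<lambda>c. transvection i j c"
  \<comment> \<open>Pigeonhole: two powers \<open>?T a\<close> and \<open>?T b\<close> lie in the
    same coset of \<open>\<Lambda>\<close>, so their quotient lies in \<open>\<Lambda>\<close> and
    \<open>m = b - a\<close> works.\<close>
  let ?f = "\<lambda>n. ?T (int n) <#\<^bsub>SL_int\<^esub> \<Lambda>"
  have T: "?T c \<in> carrier SL_int" for c
    using assms(2) by (simp add: SL_int_simps det_transvection)
  then have "range ?f \<subseteq> lcosets\<^bsub>SL_int\<^esub> \<Lambda>"
    by (auto simp: LCOSETS_def)
  then have "finite (range ?f)"
    using fin by (rule finite_subset)
  then have "\<not> inj ?f"
    using finite_imageD by blast
  then obtain a b where ab: "a < b" "?f a = ?f b"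
    unfolding inj_def by (metis linorder_neqE_nat)
  have "?T (int b) \<in> ?f a"
    using lcos_self[OF T \<Lambda>] ab(2) by simp
  from subgroup.lcos_module_imp[OF \<Lambda> is_group T this]
  have m: "?T (int b - int a) \<in> \<Lambda>"
    using assms(2) by (simp add: inv_transvection SL_int_simps transvection_add)
  have "?T ((int b - int a) * int t) \<in> \<Lambda>" for t
  proof (induction t)
    case 0
    then show ?case
      using subgroup.one_closed[OF \<Lambda>] assms(2) by (simp add: transvection_0 SL_int_simps)
  next
    case (Suc t)
    then show ?case
      using subgroup.m_closed[OF \<Lambda> m Suc] assms(2)
      by (simp add: SL_int_simps transvection_add algebra_simps)
  qed
  then show ?thesis
    using ab(1) by (intro that[of "int b - int a"]) auto
qed

lemma matrix_vector_scale:
  fixes A :: "'a::comm_semiring_1 ^ 'm ^ 'n"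
  shows "A *v (c *s x) = c *s (A *v x)"
  by (simp add: vec_eq_iff matrix_vector_mult_def sum_distrib_left mult_ac)

lemma sublattice_multiple:
  assumes "sublattice L" "a *s v \<in> L" "a dvd b"
  shows "b *s v \<in> L"
proof -
  obtain q where "b = q * a"
    using assms(3) by (metis dvdE mult.commute)
  then have "b *s v = q *s (a *s v)"
    by (simp add: vec_eq_iff)
  then show ?thesis
    using sublattice_scale[OF assms(1,2)] by simp
qed

text \<open>Makes \<open>fact k\<close> a common multiple of all differences of conjugation
  parameters below \<open>k\<close>, so that the forced multiple does not depend on which two fixed
  point sets happen to meet.\<close>

lemma dvd_fact_diff:
  assumes "s < t" "t < k"
  shows "int t - int s dvd fact k"
proof -
  have "t - s dvd fact k"
    by (rule dvd_fact) (use assms in auto)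
  then have "int (t - s) dvd int (fact k)"
    by (simp only: int_dvd_int_iff)
  then show ?thesis
    using assms by (simp add: of_nat_diff)
qed

section \<open>Forced translations in the affine group\<close>

context affine_group
begin

lemma translation_quotient:
  assumes "subgroup K \<Gamma>" "(A, v) \<in> K" "(A, w) \<in> K"
  shows "(mat 1, v - w) \<in> K"
proof -
  have c: "(A, v) \<in> carrier \<Gamma>" "(A, w) \<in> carrier \<Gamma>" "(mat 1, v - w) \<in> carrier \<Gamma>"
    using subgroup.mem_carrier[OF assms(1,2)] subgroup.mem_carrier[OF assms(1,3)] by (auto simp: one_\<Lambda>)
  have "(mat 1, v - w) = (A, v) \<otimes>\<^bsub>\<Gamma>\<^esub> inv\<^bsub>\<Gamma>\<^esub> (A, w)"
    by (subst inv_solve_right[OF c(3) c(1) c(2)]) simp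
  then show ?thesis
    using subgroup.m_closed[OF assms(1,2) subgroup.m_inv_closed[OF assms(1,3)]] by simp
qed

lemma conj_eqI:
  assumes "h \<in> carrier \<Gamma>" "g \<in> carrier \<Gamma>" "g' \<in> carrier \<Gamma>" "g' \<otimes>\<^bsub>\<Gamma>\<^esub> h = h \<otimes>\<^bsub>\<Gamma>\<^esub> g"
  shows "h \<otimes>\<^bsub>\<Gamma>\<^esub> g \<otimes>\<^bsub>\<Gamma>\<^esub> inv\<^bsub>\<Gamma>\<^esub> h = g'"
  using inv_solve_right[of g' "h \<otimes>\<^bsub>\<Gamma>\<^esub> g" h] assms by simp

lemma conj_translation:
  assumes "B \<in> \<Lambda>"
  shows "(B, 0) \<otimes>\<^bsub>\<Gamma>\<^esub> (mat 1, w) \<otimes>\<^bsub>\<Gamma>\<^esub> inv\<^bsub>\<Gamma>\<^esub> (B, 0) = (mat 1, B *v w)"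
  by (rule conj_eqI) (use assms in \<open>auto simp: one_\<Lambda>\<close>)

text \<open>If \<open>A\<close> moves \<open>u\<close>, conjugating \<open>(A, v)\<close> by the
  translation by \<open>int t *s u\<close> keeps \<open>A\<close> and adds
  \<open>int t *s (u - A *v u)\<close> to \<open>v\<close>. The quotient of two such conjugates is a
  multiple of the translation by \<open>u - A *v u\<close>.\<close>

lemma forces_translation:
  assumes "\<gamma> \<in> carrier \<Gamma>" "\<gamma> \<noteq> \<one>\<^bsub>\<Gamma>\<^esub>"
  shows "\<exists>w. w \<noteq> 0 \<and> forces TYPE('x) \<Gamma> {\<gamma>} (\<lambda>c. {(mat 1, c *s w)})"
proof -
  obtain A v where Av: "\<gamma> = (A, v)" "A \<in> \<Lambda>"
    using assms(1) by (cases \<gamma>) auto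
  show ?thesis
  proof (cases "A = mat 1")
    case True
    then have "v \<noteq> 0"
      using assms(2) Av(1) by auto
    moreover have "forces TYPE('x) \<Gamma> {\<gamma>} (\<lambda>c. {(mat 1, c *s v)})"
      by (rule forces_generated[where c = 1]) (use assms(1) Av True in auto)
    ultimately show ?thesis by blast
  next
    case False
    then obtain u where u: "A *v u \<noteq> u"
      using matrix_eq[of A "mat 1"] by auto
    let ?w = "u - A *v u"
    let ?h = "\<lambda>t :: nat. (mat 1, int t *s u) :: (int ^ 'd ^ 'd) \<times> (int ^ 'd)"
    have conj: "?h t \<otimes>\<^bsub>\<Gamma>\<^esub> \<gamma> \<otimes>\<^bsub>\<Gamma>\<^esub> inv\<^bsub>\<Gamma>\<^esub> (?h t) = (A, v + int t *s ?w)" for t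
      by (rule conj_eqI)
        (use assms(1) Av in \<open>auto simp: one_\<Lambda> matrix_vector_scale vector_ssub_ldistrib\<close>)
    have "forces TYPE('x) \<Gamma> {\<gamma>} (\<lambda>c. {(mat 1, c *s ?w)})"
    proof (rule forces_conjugates[of _ ?h])
      show "{\<gamma>} \<subseteq> carrier \<Gamma>" "?h t \<in> carrier \<Gamma>" for t
        using assms(1) by (auto simp: one_\<Lambda>)
      fix k :: nat
      have "(mat 1, fact k *s ?w) \<in> K" if st: "s < t" "t < k" and K: "subgroup K \<Gamma>"
        and mem: "(A, v + int s *s ?w) \<in> K" "(A, v + int t *s ?w) \<in> K" for s t K
      proof -
        have "(v + int t *s ?w) - (v + int s *s ?w) = (int t - int s) *s ?w"
          by (simp add: vec_eq_iff algebra_simps)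
        then have "(int t - int s) *s ?w \<in> {w. (mat 1, w) \<in> K}"
          using translation_quotient[OF K mem(2,1)] by (simp only: mem_Collect_eq)
        moreover have "int t - int s dvd fact k"
          by (rule dvd_fact_diff[OF st])
        ultimately show ?thesis
          using sublattice_multiple[OF sublattice_translations[OF K]] by blast
      qed
      then show "\<exists>c>0. \<forall>s t K. s < t \<longrightarrow> t < k \<longrightarrow> subgroup K \<Gamma> \<longrightarrow>
        (\<forall>g\<in>{\<gamma>}. ?h s \<otimes>\<^bsub>\<Gamma>\<^esub> g \<otimes>\<^bsub>\<Gamma>\<^esub> inv\<^bsub>\<Gamma>\<^esub> (?h s) \<in> K \<and> ?h t \<otimes>\<^bsub>\<Gamma>\<^esub> g \<otimes>\<^bsub>\<Gamma>\<^esub> inv\<^bsub>\<Gamma>\<^esub> (?h t) \<in> K) \<longrightarrow>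
        {(mat 1, c *s ?w)} \<subseteq> K"
        by (intro exI[of _ "fact k"]) (auto simp: conj simp del: semidirect_int_simps)
    qed
    moreover have "?w \<noteq> 0" using u by simp
    ultimately show ?thesis by blast
  qed
qed

abbreviation axis_translations :: "'d set \<Rightarrow> int \<Rightarrow> ((int ^ 'd ^ 'd) \<times> (int ^ 'd)) set" where
  "axis_translations T c \<equiv> (\<lambda>l. (mat 1, c *s axis l 1)) ` T"

lemma transvection_mult_vec:
  assumes "i \<noteq> j"
  shows "transvection i j c *v w = w + (c * w $ j) *s axis i 1"
  using assms by (auto simp: vec_eq_iff transvection_mult_vec_nth axis_def)

text \<open>Conjugating by \<open>transvection i j (m * int t)\<close> adds
  \<open>m * int t * w $ j\<close> times the axis vector \<open>i\<close> to \<open>w\<close>, so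
  quotients of conjugates are translations along axis \<open>i\<close>.\<close>

lemma forces_axis:
  fixes w :: "int ^ 'd"
  assumes "w $ j \<noteq> 0" "i \<noteq> j"
  shows "forces TYPE('x) \<Gamma> {(mat 1, w)} (axis_translations {i})"
proof -
  obtain m where m: "m > 0" "\<And>t :: nat. transvection i j (m * int t) \<in> \<Lambda>"
    using transvection_in_finite_index[OF finite_index assms(2)] by blast
  let ?h = "\<lambda>t :: nat. (transvection i j (m * int t), 0) :: (int ^ 'd ^ 'd) \<times> (int ^ 'd)"
  let ?b = "\<lambda>t :: nat. w + (m * int t * w $ j) *s axis i 1"
  have conj: "?h t \<otimes>\<^bsub>\<Gamma>\<^esub> (mat 1, w) \<otimes>\<^bsub>\<Gamma>\<^esub> inv\<^bsub>\<Gamma>\<^esub> (?h t) = (mat 1, ?b t)" for t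
    unfolding conj_translation[OF m(2)] transvection_mult_vec[OF assms(2)] ..
  show ?thesis
  proof (rule forces_conjugates[of _ ?h])
    show "{(mat 1, w)} \<subseteq> carrier \<Gamma>" "?h t \<in> carrier \<Gamma>" for t
      using m(2) by (auto simp: one_\<Lambda>)
    fix k :: nat
    \<comment> \<open>A common multiple of \<open>m * (int t - int s) * w $ j\<close> for all
      \<open>s < t < k\<close>; the absolute value makes it positive.\<close>
    let ?c = "m * fact k * \<bar>w $ j\<bar>"
    have "(mat 1, ?c *s axis i 1) \<in> K" if st: "s < t" "t < k" and K: "subgroup K \<Gamma>"
      and mem: "(mat 1, ?b s) \<in> K" "(mat 1, ?b t) \<in> K" for s t K
    proof -
      have "?b t - ?b s = (m * (int t - int s) * w $ j) *s axis i 1"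
        by (simp add: vec_eq_iff algebra_simps)
      then have "(m * (int t - int s) * w $ j) *s axis i 1 \<in> {w. (mat 1, w) \<in> K}"
        using translation_quotient[OF K mem(2,1)] by (simp only: mem_Collect_eq)
      moreover have "m * (int t - int s) * w $ j dvd ?c"
        using dvd_fact_diff[OF st] by (intro mult_dvd_mono) auto
      ultimately show ?thesis
        using sublattice_multiple[OF sublattice_translations[OF K]] by blast
    qed
    then show "\<exists>c>0. \<forall>s t K. s < t \<longrightarrow> t < k \<longrightarrow> subgroup K \<Gamma> \<longrightarrow>
        (\<forall>g\<in>{(mat 1, w)}. ?h s \<otimes>\<^bsub>\<Gamma>\<^esub> g \<otimes>\<^bsub>\<Gamma>\<^esub> inv\<^bsub>\<Gamma>\<^esub> (?h s) \<in> K \<and> ?h t \<otimes>\<^bsub>\<Gamma>\<^esub> g \<otimes>\<^bsub>\<Gamma>\<^esub> inv\<^bsub>\<Gamma>\<^esub> (?h t) \<in> K) \<longrightarrow>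
        axis_translations {i} c \<subseteq> K"
      using m(1) assms(1) by (intro exI[of _ ?c]) (auto simp: conj simp del: semidirect_int_simps)
  qed
qed

text \<open>The axis is fixed before \<open>c\<close>, as chaining by \<open>forces_trans\<close>
  requires one target for all multiples of \<open>w\<close>.\<close>

lemma forces_some_axis:
  fixes w :: "int ^ 'd"
  assumes "w \<noteq> 0"
  shows "\<exists>i. \<forall>c>0. forces TYPE('x) \<Gamma> {(mat 1, c *s w)} (axis_translations {i})"
proof -
  obtain j where j: "w $ j \<noteq> 0"
    using assms by (auto simp: vec_eq_iff)
  show ?thesis
  proof (cases "\<exists>i. i \<noteq> j")
    case True
    then obtain i where "i \<noteq> j" by blast
    then have "forces TYPE('x) \<Gamma> {(mat 1, c *s w)} (axis_translations {i})" if "c > 0" for c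
      using that j by (intro forces_axis[of _ j]) auto
    then show ?thesis by blast
  next
    \<comment> \<open>In dimension one there is no transvection, but \<open>w\<close> already lies
      on the only axis.\<close>
    case False
    have "forces TYPE('x) \<Gamma> {(mat 1, c *s w)} (axis_translations {j})" if "c > 0" for c
    proof (rule forces_generated[where c = "\<bar>c * w $ j\<bar>"])
      fix K assume K: "subgroup K \<Gamma>" "{(mat 1, c *s w)} \<subseteq> K"
      have "c *s w = (c * w $ j) *s axis j 1"
        using False by (auto simp: vec_eq_iff axis_def)
      then have "(c * w $ j) *s axis j 1 \<in> {v. (mat 1, v) \<in> K}"
        using K(2) by simp
      then have "\<bar>c * w $ j\<bar> *s axis j 1 \<in> {v. (mat 1, v) \<in> K}"
        by (rule sublattice_multiple[OF sublattice_translations[OF K(1)]]) simp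
      then show "axis_translations {j} \<bar>c * w $ j\<bar> \<subseteq> K" by simp
    qed (use j that one_\<Lambda> in auto)
    then show ?thesis by blast
  qed
qed

text \<open>Conjugating by \<open>transvection j i t\<close> changes \<open>a e\<^sub>i\<close> into \<open>a e\<^sub>i + t a e\<^sub>j\<close> and fixes the other axes;
  the difference of two such vectors is a multiple of \<open>e\<^sub>j\<close>.\<close>

lemma forces_next_axis:
  assumes "i \<in> T" "j \<notin> T" "a > 0"
  shows "forces TYPE('x) \<Gamma> (axis_translations T a) (axis_translations (insert j T))"
proof -
  have ij: "j \<noteq> i" using assms by auto
  obtain m where m: "m > 0" "\<And>t :: nat. transvection j i (m * int t) \<in> \<Lambda>"
    using transvection_in_finite_index[OF finite_index ij] by blast
  let ?h = "\<lambda>t :: nat. (transvection j i (m * int t), 0) :: (int ^ 'd ^ 'd) \<times> (int ^ 'd)"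
  let ?b = "\<lambda>(t :: nat) l. if l = i then a *s axis i 1 + (m * int t * a) *s axis j 1 else a *s axis l 1"
  have conj: "?h t \<otimes>\<^bsub>\<Gamma>\<^esub> (mat 1, a *s axis l 1) \<otimes>\<^bsub>\<Gamma>\<^esub> inv\<^bsub>\<Gamma>\<^esub> (?h t) = (mat 1, ?b t l)" for t l
    unfolding conj_translation[OF m(2)] transvection_mult_vec[OF ij] by (simp add: axis_def)
  show ?thesis
  proof (rule forces_conjugates[of _ ?h])
    show "axis_translations T a \<subseteq> carrier \<Gamma>" "?h t \<in> carrier \<Gamma>" for t
      using m(2) by (auto simp: one_\<Lambda>)
    fix k :: nat
    \<comment> \<open>A multiple of each \<open>m * (int t - int s) * a\<close>, for the new axis,
      and of \<open>a\<close>, for the old ones.\<close>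
    let ?c = "m * fact k * a"
    have fixed: "(mat 1, ?c *s axis l 1) \<in> K" if st: "s < t" "t < k" and K: "subgroup K \<Gamma>"
      and mem: "\<forall>l\<in>T. (mat 1, ?b s l) \<in> K \<and> (mat 1, ?b t l) \<in> K" and l: "l \<in> insert j T" for s t K l
    proof -
      define L where "L = {v. (mat 1, v) \<in> K}"
      have L: "sublattice L"
        unfolding L_def by (rule sublattice_translations[OF K])
      have bs: "?b s i \<in> L" "?b t i \<in> L"
        using mem assms(1) by (auto simp: L_def)
      have "?b t i - ?b s i = (m * (int t - int s) * a) *s axis j 1"
        by (simp add: vec_eq_iff algebra_simps)
      then have "(m * (int t - int s) * a) *s axis j 1 \<in> L"
        using sublattice_diff[OF L bs(2,1)] by simp
      moreover have "m * (int t - int s) * a dvd ?c"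
        using dvd_fact_diff[OF st] by (intro mult_dvd_mono) auto
      ultimately have cj: "?c *s axis j 1 \<in> L"
        by (rule sublattice_multiple[OF L])
      consider "l = j" | "l = i" | "l \<in> T" "l \<noteq> i" using l by blast
      then have "?c *s axis l 1 \<in> L"
      proof cases
        case 2
        \<comment> \<open>Conjugation has tilted axis \<open>i\<close> towards \<open>j\<close>; a
          multiple of the new axis vector removes the tilt.\<close>
        have "?c *s axis i 1 = (m * fact k) *s ?b s i - (m * int s) *s (?c *s axis j 1)"
          by (simp add: vec_eq_iff algebra_simps)
        then show ?thesis
          unfolding 2 using bs(1) cj L by (simp only: sublattice_diff sublattice_scale)
      next
        case 3
        then have "a *s axis l 1 \<in> L"
          using mem by (force simp: L_def)
        then show ?thesis
          by (rule sublattice_multiple[OF L]) simp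
      qed (use cj in simp)
      then show ?thesis by (simp add: L_def)
    qed
    show "\<exists>c>0. \<forall>s t K. s < t \<longrightarrow> t < k \<longrightarrow> subgroup K \<Gamma> \<longrightarrow>
        (\<forall>g\<in>axis_translations T a. ?h s \<otimes>\<^bsub>\<Gamma>\<^esub> g \<otimes>\<^bsub>\<Gamma>\<^esub> inv\<^bsub>\<Gamma>\<^esub> (?h s) \<in> K \<and> ?h t \<otimes>\<^bsub>\<Gamma>\<^esub> g \<otimes>\<^bsub>\<Gamma>\<^esub> inv\<^bsub>\<Gamma>\<^esub> (?h t) \<in> K) \<longrightarrow>
        axis_translations (insert j T) c \<subseteq> K"
    proof (intro exI[of _ ?c] conjI allI impI image_subsetI)
      show "?c > 0" using m(1) assms(3) by simp
      fix s t K l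
      assume st: "s < t" "t < k" "subgroup K \<Gamma>" and l: "l \<in> insert j T"
        and *: "\<forall>g\<in>axis_translations T a. ?h s \<otimes>\<^bsub>\<Gamma>\<^esub> g \<otimes>\<^bsub>\<Gamma>\<^esub> inv\<^bsub>\<Gamma>\<^esub> (?h s) \<in> K \<and> ?h t \<otimes>\<^bsub>\<Gamma>\<^esub> g \<otimes>\<^bsub>\<Gamma>\<^esub> inv\<^bsub>\<Gamma>\<^esub> (?h t) \<in> K"
      have "\<forall>l\<in>T. (mat 1, ?b s l) \<in> K \<and> (mat 1, ?b t l) \<in> K"
        using * unfolding Set.ball_simps(9) conj .
      from fixed[OF st this l] show "(mat 1, ?c *s axis l 1) \<in> K" .
    qed
  qed
qed

text \<open>Finitely many applications of \<open>forces_trans\<close>: first to a translation, then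
  to one axis, then adding the other axes one at a time.\<close>

lemma forces_all_axes:
  assumes "\<gamma> \<in> carrier \<Gamma>" "\<gamma> \<noteq> \<one>\<^bsub>\<Gamma>\<^esub>"
  shows "forces TYPE('x) \<Gamma> {\<gamma>} (axis_translations UNIV)"
proof -
  obtain w where w: "w \<noteq> 0" "forces TYPE('x) \<Gamma> {\<gamma>} (\<lambda>c. {(mat 1, c *s w)})"
    using forces_translation[OF assms] by blast
  obtain i where i: "\<And>c. c > 0 \<Longrightarrow> forces TYPE('x) \<Gamma> {(mat 1, c *s w)} (axis_translations {i})"
    using forces_some_axis[OF w(1)] by blast
  have "forces TYPE('x) \<Gamma> {\<gamma>} (axis_translations (insert i T))" if "finite T" for T
    using that
  proof (induction T rule: finite_induct)
    case empty
    then show ?case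
      using forces_trans[OF w(2) i] by simp
  next
    case (insert j T)
    show ?case
    proof (cases "j = i")
      case True
      then show ?thesis using insert.IH by simp
    next
      case False
      have "forces TYPE('x) \<Gamma> {\<gamma>} (axis_translations (insert j (insert i T)))"
        by (rule forces_trans[OF insert.IH forces_next_axis[of i]]) (use insert.hyps False in auto)
      then show ?thesis by (simp add: insert_commute)
    qed
  qed
  from this[of UNIV] show ?thesis by simp
qed

end

section \<open>Essential freeness\<close>

lemma (in group) group_action_lcosets:
  assumes H: "subgroup H G"
  shows "group_action G (lcosets H) (lcoset_action G H)"
proof -
  let ?X = "lcosets H" and ?\<phi> = "lcoset_action G H"
  have sub: "C \<subseteq> carrier G" if "C \<in> ?X" for C
    by (rule subgroup.lcosets_carrier[OF H is_group that])
  have closed: "g <# C \<in> ?X" if "g \<in> carrier G" "C \<in> ?X" for g C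
    by (rule l_coset_lcosets[OF H that])
  have inv: "inv g <# (g <# C) = C" "g <# (inv g <# C) = C" if "g \<in> carrier G" "C \<in> ?X" for g C
    using that sub by (simp_all add: lcos_m_assoc lcos_mult_one)
  have bij: "?\<phi> g \<in> carrier (BijGroup ?X)" if g: "g \<in> carrier G" for g
  proof -
    have "bij_betw (?\<phi> g) ?X ?X"
      by (rule bij_betw_byWitness[where f' = "?\<phi> (inv g)"])
        (use g closed inv in \<open>auto simp: lcoset_action_def\<close>)
    then show ?thesis
      by (simp add: BijGroup_def Bij_def lcoset_action_def)
  qed
  have "?\<phi> (g \<otimes> h) = ?\<phi> g \<otimes>\<^bsub>BijGroup ?X\<^esub> ?\<phi> h" if g: "g \<in> carrier G" "h \<in> carrier G" for g h
    using bij[OF g(1)] bij[OF g(2)] closed sub g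
    by (auto simp: BijGroup_def lcoset_action_def compose_def fun_eq_iff lcos_m_assoc)
  then have "?\<phi> \<in> hom G (BijGroup ?X)"
    using bij by (intro homI) auto
  then show ?thesis
    by (intro group_action.intro group_hom.intro group_hom_axioms.intro is_group group_BijGroup)
qed

text \<open>A class with nontrivial stabilizer is fixed by some
  \<open>\<gamma> \<noteq> \<one>\<close>, which means that its coordinates are fixed by
  \<open>\<gamma>\<close> along \<open>U\<close>. It thus lies in the internal set
  \<open>N \<gamma>\<close> of fixed points, which is null; countability of the group makes the
  union of these sets null.\<close>

lemma sofic_approximationI:
  assumes "group G" "countable (carrier G)"
    and X: "\<And>n. finite (X n)" "\<And>n. X n \<noteq> {}" and act: "\<And>n. group_action G (X n) (\<phi> n)"
    and fixed_null: "\<And>\<gamma>. \<gamma> \<in> carrier G \<Longrightarrow> \<gamma> \<noteq> \<one>\<^bsub>G\<^esub> \<Longrightarrow>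
      (\<lambda>n. real (card (fixed_points (X n) (\<phi> n) {\<gamma>})) / real (card (X n))) \<longlonglongrightarrow> 0"
  shows "sofic_approximation G X \<phi>"
  unfolding sofic_approximation_def
proof (intro conjI allI impI)
  show "finite (X n)" "X n \<noteq> {}" "group_action G (X n) (\<phi> n)" for n
    by (fact X act)+
  interpret group G by fact
  fix U :: "nat filter" assume U: "nonprincipal_ultrafilter U"
  interpret finite_ultraproduct U X
    by unfold_locales (fact U X)+
  let ?M = "loeb_measure U X" and ?\<psi> = "ultra_action U X \<phi>"
  define A where "A \<gamma> n = fixed_points (X n) (\<phi> n) {\<gamma>}" for \<gamma> n
  have A: "A \<gamma> n \<subseteq> X n" for \<gamma> n
    by (auto simp: A_def fixed_points_def)
  define N where "N \<gamma> = internal_set U X (A \<gamma>)" for \<gamma>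
  have null: "N \<gamma> \<in> null_sets ?M" if \<gamma>: "\<gamma> \<in> carrier G - {\<one>\<^bsub>G\<^esub>}" for \<gamma>
  proof
    \<comment> \<open>A non-principal ultrafilter refines \<open>sequentially\<close>, so ordinary
      limits are also limits along \<open>U\<close>.\<close>
    have "((\<lambda>n. real (card (A \<gamma> n)) / real (card (X n))) \<longlongrightarrow> 0) U"
      by (rule filterlim_mono[OF fixed_null order_refl nonprincipal_ultrafilter_le_sequentially[OF U], of \<gamma>, folded A_def])
        (use \<gamma> in auto)
    then have "Lim U (\<lambda>n. real (card (A \<gamma> n)) / real (card (X n))) = 0"
      by (rule tendsto_Lim[OF U_bot])
    then show "emeasure ?M (N \<gamma>) = 0"
      using emeasure_loeb_internal[of "A \<gamma>"] A by (simp add: N_def)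
    show "N \<gamma> \<in> sets ?M"
      unfolding sets_loeb N_def using A by (intro sigma_sets.Basic) auto
  qed
  have "(\<Union>\<gamma>\<in>carrier G - {\<one>\<^bsub>G\<^esub>}. N \<gamma>) \<in> null_sets ?M"
    using null assms(2) by (intro null_sets_UN') auto
  moreover have "{p \<in> space ?M. \<not> stabilizer G ?\<psi> p = {\<one>\<^bsub>G\<^esub>}} \<subseteq> (\<Union>\<gamma>\<in>carrier G - {\<one>\<^bsub>G\<^esub>}. N \<gamma>)"
  proof
    fix p assume "p \<in> {p \<in> space ?M. \<not> stabilizer G ?\<psi> p = {\<one>\<^bsub>G\<^esub>}}"
    then have p: "p \<in> ultraproduct U X" and nontrivial: "stabilizer G ?\<psi> p \<noteq> {\<one>\<^bsub>G\<^esub>}"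
      by (auto simp: space_loeb)
    obtain x where x: "x \<in> Pi UNIV X" "p = ultra_rel U X `` {x}"
      using p by (auto simp: ultraproduct_def quotient_def)
    have closed: "\<phi> n \<gamma> y \<in> X n" if "\<gamma> \<in> carrier G" "y \<in> X n" for n \<gamma> y
      using group_action.element_image[OF act that] by simp
    then have \<psi>: "?\<psi> \<gamma> p = ultra_rel U X `` {\<lambda>n. \<phi> n \<gamma> (x n)}" if "\<gamma> \<in> carrier G" for \<gamma>
      unfolding x(2) using that by (intro ultra_action_class x(1)) auto
    have "\<phi> n \<one>\<^bsub>G\<^esub> (x n) = x n" for n
      using group_action.id_eq_one[OF act, of n] x(1) by (metis PiE UNIV_I restrict_apply')
    then have "\<one>\<^bsub>G\<^esub> \<in> stabilizer G ?\<psi> p"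
      using \<psi>[of "\<one>\<^bsub>G\<^esub>"] by (simp add: stabilizer_def flip: x(2))
    with nontrivial obtain \<gamma> where \<gamma>: "\<gamma> \<in> carrier G" "\<gamma> \<noteq> \<one>\<^bsub>G\<^esub>" "?\<psi> \<gamma> p = p"
      by (auto simp: stabilizer_def)
    have "ultra_rel U X `` {\<lambda>n. \<phi> n \<gamma> (x n)} = ultra_rel U X `` {x}"
      using \<gamma>(3) \<psi>[OF \<gamma>(1)] x(2) by simp
    then have "(\<lambda>n. \<phi> n \<gamma> (x n), x) \<in> ultra_rel U X"
      by (rule eq_equiv_class[OF _ equiv_ultra_rel x(1)])
    then have "\<forall>\<^sub>F n in U. \<phi> n \<gamma> (x n) = x n"
      by (simp add: ultra_rel_def)
    then have "\<forall>\<^sub>F n in U. x n \<in> A \<gamma> n"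
      by eventually_elim (use x(1) in \<open>auto simp: A_def fixed_points_def\<close>)
    then have "p \<in> N \<gamma>"
      unfolding N_def x(2) using class_in_internal_iff[OF x(1)] by simp
    then show "p \<in> (\<Union>\<gamma>\<in>carrier G - {\<one>\<^bsub>G\<^esub>}. N \<gamma>)"
      using \<gamma> by blast
  qed
  ultimately show "essentially_free G ?M ?\<psi>"
    unfolding essentially_free_def by (rule AE_I')
qed

section \<open>From a fixed coset to a bounded translation index\<close>

lemma finite_int_box: "finite {v :: int ^ 'd. \<forall>i. v $ i \<in> {0..<c}}"
proof -
  have "{v :: int ^ 'd. \<forall>i. v $ i \<in> {0..<c}} \<subseteq> vec_lambda ` (UNIV \<rightarrow>\<^sub>E {0..<c})"
    by (auto intro!: image_eqI[of _ _ "vec_nth _"] simp: PiE_def)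
  then show ?thesis
    by (rule finite_subset) (intro finite_imageI finite_PiE, auto)
qed

context affine_group
begin

text \<open>Reducing coordinates modulo \<open>c\<close> changes a translation by an element of
  \<open>H\<close>, so the vectors with coordinates in \<open>{0..<c}\<close> represent all
  cosets.\<close>

lemma translation_index_le:
  assumes H: "subgroup H \<Gamma>" and c: "c > 0" "\<And>v. (mat 1, c *s v) \<in> H"
  shows "group_index (\<Gamma>\<lparr>carrier := translation_subgroup\<rparr>) (H \<inter> translation_subgroup)
    \<le> card {v :: int ^ 'd. \<forall>i. v $ i \<in> {0..<c}}"
proof -
  let ?N = "\<Gamma>\<lparr>carrier := translation_subgroup\<rparr>" and ?B = "{v :: int ^ 'd. \<forall>i. v $ i \<in> {0..<c}}"
  let ?L = "H \<inter> translation_subgroup"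
  let ?f = "\<lambda>v. (mat 1, v) <#\<^bsub>?N\<^esub> ?L"
  have T: "subgroup translation_subgroup \<Gamma>"
    by (rule subgroup_translation_subgroup[OF \<Lambda>])
  interpret N: group ?N
    by (rule subgroup_imp_group[OF T])
  have L: "subgroup ?L ?N"
    by (rule subgroup_incl[OF subgroups_Inter_pair[OF H T] T]) simp
  have "lcosets\<^bsub>?N\<^esub> ?L \<subseteq> ?f ` ?B"
  proof
    fix C assume "C \<in> lcosets\<^bsub>?N\<^esub> ?L"
    then obtain v where v: "C = ?f v"
      by (auto simp: LCOSETS_def translation_subgroup_def)
    define w q where "w = (\<chi> i. v $ i mod c)" and "q = (\<chi> i. v $ i div c)"
    have "v = w + c *s q"
      by (simp add: vec_eq_iff w_def q_def)
    then have "(mat 1, v) = (mat 1, w) \<otimes>\<^bsub>?N\<^esub> (mat 1, c *s q)"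
      by simp
    moreover have "(mat 1, c *s q) \<in> ?L"
      using c(2) by (simp add: translation_subgroup_def)
    ultimately have "(mat 1, v) \<in> ?f w"
      unfolding l_coset_def by blast
    then have "?f w = ?f v"
      by (rule N.l_repr_independence[OF _ _ L]) (simp add: translation_subgroup_def)
    moreover have "w \<in> ?B"
      using c(1) by (simp add: w_def)
    ultimately show "C \<in> ?f ` ?B"
      using v by blast
  qed
  then show ?thesis
    unfolding group_index_def
    by (rule surj_card_le[OF finite_int_box])
qed

text \<open>The axis translations generate all translations by multiples of \<open>c\<close>, and
  these form a normal subgroup. Fixing one coset \<open>g H\<close> therefore places them in
  \<open>H\<close> itself.\<close>

lemma coset_fixed_by_axes:
  assumes H: "subgroup H \<Gamma>" and C: "C \<in> fixed_points (lcosets\<^bsub>\<Gamma>\<^esub> H) (lcoset_action \<Gamma> H) (axis_translations UNIV c)"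
  shows "(mat 1, c *s v) \<in> H"
proof -
  interpret group_action \<Gamma> "lcosets\<^bsub>\<Gamma>\<^esub> H" "lcoset_action \<Gamma> H"
    by (rule group_action_lcosets[OF H])
  have CX: "C \<in> lcosets\<^bsub>\<Gamma>\<^esub> H"
    using C by (simp add: fixed_points_def)
  define K where "K = stabilizer \<Gamma> (lcoset_action \<Gamma> H) C"
  have K: "sublattice {u. (mat 1, u) \<in> K}"
    unfolding K_def by (rule sublattice_translations[OF stabilizer_subgroup[OF CX]])
  have axes: "c *s axis l 1 \<in> {u. (mat 1, u) \<in> K}" for l
    using C by (auto simp: K_def fixed_points_def stabilizer_def one_\<Lambda>)
  have stab: "(\<Sum>l\<in>UNIV. u $ l *s (c *s axis l 1)) \<in> {u. (mat 1, u) \<in> K}" for u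
    by (rule sublattice_sum[OF K], rule sublattice_scale[OF K axes])
  have sum: "(\<Sum>l\<in>UNIV. u $ l *s (c *s axis l 1)) = c *s u" for u :: "int ^ 'd"
    by (simp add: vec_eq_iff axis_def if_distrib cong: if_cong)
  obtain B b where g: "(B, b) \<in> C"
    using lcosets_nonempty[OF H CX] by auto
  have Bb: "(B, b) \<in> carrier \<Gamma>" "C = (B, b) <#\<^bsub>\<Gamma>\<^esub> H"
    using lcosets_eq_l_coset[OF H CX g] .
  \<comment> \<open>The vector \<open>B *v v\<close> is chosen because moving this translation past
    \<open>(B, b)\<close> turns it into the translation by \<open>c *s v\<close>.\<close>
  have "(mat 1, c *s (B *v v)) \<in> K"
    using stab[of "B *v v"] unfolding sum by simp
  then have "(mat 1, c *s (B *v v)) <#\<^bsub>\<Gamma>\<^esub> C = C"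
    using CX by (simp add: K_def stabilizer_def lcoset_action_def)
  moreover have "(mat 1, c *s (B *v v)) \<otimes>\<^bsub>\<Gamma>\<^esub> (B, b) \<in> (mat 1, c *s (B *v v)) <#\<^bsub>\<Gamma>\<^esub> C"
    using g unfolding l_coset_def by blast
  moreover have "(mat 1, c *s (B *v v)) \<otimes>\<^bsub>\<Gamma>\<^esub> (B, b) = (B, b) \<otimes>\<^bsub>\<Gamma>\<^esub> (mat 1, c *s v)"
    by (simp add: matrix_vector_scale)
  ultimately have "(B, b) \<otimes>\<^bsub>\<Gamma>\<^esub> (mat 1, c *s v) \<in> C"
    by metis
  from lcosets_quotient[OF H CX g this]
  show ?thesis
    using Bb(1) by (simp add: m_assoc[symmetric] one_\<Lambda> del: semidirect_int_simps(2,3))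
qed

text \<open>Contrapositive: if the density is at least \<open>\<epsilon>\<close>, then
  \<open>axis_translations UNIV c\<close> fixes a positive proportion of cosets, hence at least one,
  and the translation index is at most the number of residue vectors modulo \<open>c\<close>. As
  \<open>c\<close> depends only on \<open>\<gamma>\<close> and \<open>\<epsilon>\<close>, so does
  \<open>D\<close>.\<close>

lemma fixed_points_density:
  assumes "\<gamma> \<in> carrier \<Gamma>" "\<gamma> \<noteq> \<one>\<^bsub>\<Gamma>\<^esub>" "\<epsilon> > 0"
  shows "\<exists>D. \<forall>H. finite_index_subgroup H \<Gamma> \<longrightarrow>
    D < group_index (\<Gamma>\<lparr>carrier := translation_subgroup\<rparr>) (H \<inter> translation_subgroup) \<longrightarrow>
    real (card (fixed_points (lcosets\<^bsub>\<Gamma>\<^esub> H) (lcoset_action \<Gamma> H) {\<gamma>})) < \<epsilon> * real (card (lcosets\<^bsub>\<Gamma>\<^esub> H))"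
proof -
  obtain c \<delta> where c: "c > 0" "\<delta> > 0" and dense:
    "\<And>(X :: ((int ^ 'd ^ 'd) \<times> (int ^ 'd)) set set) \<phi>. group_action \<Gamma> X \<phi> \<Longrightarrow> finite X \<Longrightarrow> X \<noteq> {} \<Longrightarrow>
     \<epsilon> * real (card X) \<le> real (card (fixed_points X \<phi> {\<gamma>})) \<Longrightarrow>
     \<delta> * real (card X) \<le> real (card (fixed_points X \<phi> (axis_translations UNIV c)))"
    using forces_all_axes[OF assms(1,2), where 'x = "((int ^ 'd ^ 'd) \<times> (int ^ 'd)) set"] assms(3)
    unfolding forces_def by meson
  let ?D = "card {v :: int ^ 'd. \<forall>i. v $ i \<in> {0..<c}}"
  have "group_index (\<Gamma>\<lparr>carrier := translation_subgroup\<rparr>) (H \<inter> translation_subgroup) \<le> ?D"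
    if H: "finite_index_subgroup H \<Gamma>" and
      ge: "\<epsilon> * real (card (lcosets\<^bsub>\<Gamma>\<^esub> H)) \<le> real (card (fixed_points (lcosets\<^bsub>\<Gamma>\<^esub> H) (lcoset_action \<Gamma> H) {\<gamma>}))"
    for H
  proof -
    have H': "subgroup H \<Gamma>" "finite (lcosets\<^bsub>\<Gamma>\<^esub> H)" "lcosets\<^bsub>\<Gamma>\<^esub> H \<noteq> {}"
      using H subgroup_in_lcosets by (auto simp: finite_index_subgroup_def)
    let ?F = "fixed_points (lcosets\<^bsub>\<Gamma>\<^esub> H) (lcoset_action \<Gamma> H) (axis_translations UNIV c)"
    have "\<delta> * real (card (lcosets\<^bsub>\<Gamma>\<^esub> H)) \<le> real (card ?F)"
      by (rule dense[OF group_action_lcosets[OF H'(1)] H'(2,3) ge])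
    moreover have "\<delta> * real (card (lcosets\<^bsub>\<Gamma>\<^esub> H)) > 0"
      using c(2) H'(2,3) by (simp add: card_gt_0_iff)
    ultimately have "?F \<noteq> {}" by auto
    then show ?thesis
      using translation_index_le[OF H'(1) c(1)] coset_fixed_by_axes[OF H'(1)] by blast
  qed
  then show ?thesis
    by (meson leD leI)
qed

lemma sofic:
  assumes \<Gamma>s: "\<And>n. finite_index_subgroup (\<Gamma>s n) \<Gamma>"
    and index: "filterlim
        (\<lambda>n. group_index (\<Gamma>\<lparr>carrier := translation_subgroup\<rparr>) (\<Gamma>s n \<inter> translation_subgroup))
        at_top sequentially"
  shows "sofic_approximation \<Gamma> (\<lambda>n. lcosets\<^bsub>\<Gamma>\<^esub> (\<Gamma>s n)) (\<lambda>n. lcoset_action \<Gamma> (\<Gamma>s n))"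
proof (rule sofic_approximationI)
  have sub: "subgroup (\<Gamma>s n) \<Gamma>" and fin: "finite (lcosets\<^bsub>\<Gamma>\<^esub> (\<Gamma>s n))" for n
    using \<Gamma>s[of n] by (auto simp: finite_index_subgroup_def)
  show "group \<Gamma>" by (rule is_group)
  show "countable (carrier \<Gamma>)" by simp
  show "finite (lcosets\<^bsub>\<Gamma>\<^esub> (\<Gamma>s n))" for n by (rule fin)
  show "lcosets\<^bsub>\<Gamma>\<^esub> (\<Gamma>s n) \<noteq> {}" for n
    using subgroup_in_lcosets[OF sub] by blast
  then have pos: "real (card (lcosets\<^bsub>\<Gamma>\<^esub> (\<Gamma>s n))) > 0" for n
    using fin by (simp add: card_gt_0_iff)
  show "group_action \<Gamma> (lcosets\<^bsub>\<Gamma>\<^esub> (\<Gamma>s n)) (lcoset_action \<Gamma> (\<Gamma>s n))" for n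
    by (rule group_action_lcosets[OF sub])
  fix \<gamma> assume \<gamma>: "\<gamma> \<in> carrier \<Gamma>" "\<gamma> \<noteq> \<one>\<^bsub>\<Gamma>\<^esub>"
  let ?r = "\<lambda>n. real (card (fixed_points (lcosets\<^bsub>\<Gamma>\<^esub> (\<Gamma>s n)) (lcoset_action \<Gamma> (\<Gamma>s n)) {\<gamma>})) /
      real (card (lcosets\<^bsub>\<Gamma>\<^esub> (\<Gamma>s n)))"
  show "?r \<longlonglongrightarrow> 0"
  proof (rule order_tendstoI)
    fix a :: real assume "a < 0"
    then have "a < ?r n" for n
      by (rule less_le_trans) simp
    then show "\<forall>\<^sub>F n in sequentially. a < ?r n" by simp
  next
    fix \<epsilon> :: real assume "0 < \<epsilon>"
    with fixed_points_density[OF \<gamma>] obtain D where D: "\<And>H. finite_index_subgroup H \<Gamma> \<Longrightarrow>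
      D < group_index (\<Gamma>\<lparr>carrier := translation_subgroup\<rparr>) (H \<inter> translation_subgroup) \<Longrightarrow>
      real (card (fixed_points (lcosets\<^bsub>\<Gamma>\<^esub> H) (lcoset_action \<Gamma> H) {\<gamma>})) < \<epsilon> * real (card (lcosets\<^bsub>\<Gamma>\<^esub> H))"
      by meson
    have "\<forall>\<^sub>F n in sequentially. D < group_index (\<Gamma>\<lparr>carrier := translation_subgroup\<rparr>) (\<Gamma>s n \<inter> translation_subgroup)"
      using index[unfolded filterlim_at_top, rule_format, of "Suc D"] by (simp add: Suc_le_eq)
    then show "\<forall>\<^sub>F n in sequentially. ?r n < \<epsilon>"
      by eventually_elim (use D[OF \<Gamma>s] pos in \<open>simp add: pos_divide_less_eq\<close>)
  qed
qed

end

theorem theorem1p7: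
  fixes \<Lambda> :: "(int ^ 'd ^ 'd) set"
    and \<Gamma> :: "((int ^ 'd ^ 'd) \<times> (int ^ 'd)) monoid"
    and \<Gamma>s :: "nat \<Rightarrow> ((int ^ 'd ^ 'd) \<times> (int ^ 'd)) set"
  assumes \<Lambda>: "finite_index_subgroup \<Lambda> SL_int"
    and \<Gamma>: "\<Gamma> = semidirect_int \<Lambda>"
    and \<Gamma>s: "\<And>n. finite_index_subgroup (\<Gamma>s n) \<Gamma>"
    and index: "filterlim
        (\<lambda>n. group_index (\<Gamma>\<lparr>carrier := translation_subgroup\<rparr>) (\<Gamma>s n \<inter> translation_subgroup))
        at_top sequentially"
  shows "sofic_approximation \<Gamma> (\<lambda>n. lcosets\<^bsub>\<Gamma>\<^esub> (\<Gamma>s n)) (\<lambda>n. lcoset_action \<Gamma> (\<Gamma>s n))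
    \<and> (\<lambda>n. (ereal_of_enat (group_rank (\<Gamma>\<lparr>carrier := \<Gamma>s n\<rparr>)) - 1)
            / ereal (real (group_index \<Gamma> (\<Gamma>s n)))) \<longlonglongrightarrow> 0"
proof -
  interpret affine_group \<Lambda>
    by unfold_locales (fact \<Lambda>)
  show ?thesis
    using sofic[of \<Gamma>s] rank_gradient[of \<Gamma>s] \<Gamma>s index unfolding \<Gamma> by blast
qed

end
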